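(* Let $(V,H,V')$ be a normal triple of Hilbert spaces, $T>0$, let $\mathbf{A}:V\to V'$ be a bounded linear operator satisfying assumption (A) stated in the context, and let $\mathbf{M}_k:V\to V'$, $k\ge 1$, be bounded linear operators. Let $u_0\in\bar{\mathcal R}L_2(\mathbb F;H)$ and $f\in\bar{\mathcal R}L_2(\mathbb F;\mathcal V')$ for some operator $\bar{\mathcal R}$ (i.e. for some system of positive, uniformly bounded weights $\{\bar r_\alpha\}$). Then there exist an operator $\mathcal R$ (i.e. a system of positive, uniformly bounded weights $\{r_\alpha,\ \alpha\in\mathcal J\}$) and a unique solution $u\in\mathcal R L_2(\mathbb F;\mathcal V)$ of the equation $$\dot u(t)=\mathbf A u(t)+f(t)+\sum_{k\ge1}(\mathbf M_k u(t))\diamond\xi_k,\quad 0<t\le T,\qquad u|_{t=0}=u_0 .$$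
   Context: Wiener chaos. $\mathbb F=(\Omega,\mathcal F,\mathbb P)$ is a complete probability space, $\mathcal U$ a real separable Hilbert space with orthonormal basis $\{\mathfrak u_k\}_{k\ge1}$, $\dot W=\{\dot W(h),h\in\mathcal U\}$ a zero-mean Gaussian family with $\mathbb E(\dot W(h_1)\dot W(h_2))=(h_1,h_2)_{\mathcal U}$, and $\mathcal F$ is generated by $\dot W$. Put $\xi_k=\dot W(\mathfrak u_k)$ (independent standard Gaussian). $\mathcal J$ is the set of multi-indices $\alpha=(\alpha_1,\alpha_2,\dots)$ of non-negative integers with $|\alpha|=\sum_k\alpha_k<\infty$; $\alpha!=\prod_k\alpha_k!$; $\varepsilon_k$ is the multi-index with $1$ in position $k$ and $0$ elsewhere. $\xi_\alpha=\prod_k H_{\alpha_k}(\xi_k)/\sqrt{\alpha_k!}$, $H_n(x)=(-1)^ne^{x^2/2}\frac{d^n}{dx^n}e^{-x^2/2}$; these form an orthonormal basis of $L_2(\mathbb F)$. Weighted spaces. For a system of positive weights $\{r_\alpha\}_{\alpha\in\mathcal J}$ (identified with the operator $\mathcal R\xi_\alpha=r_\alpha\xi_\alpha$) and a Hilbert space $X$, $\mathcal R L_2(\mathbb F;X)$ is the space of formal series $v=\sum_{\alpha}v_\alpha\xi_\alpha$, $v_\alpha\in X$, with $\|v\|^2_{\mathcal R L_2(\mathbb F;X)}=\sum_\alpha r_\alpha^2\|v_\alpha\|_X^2<\infty$. Normal triple: Hilbert spaces with dense continuous embeddings $V\hookrightarrow H\hookrightarrow V'$, $V'$ is the dual of $V$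 relative to the inner product of $H$, and $|(h,v)_H|\le C\|v\|_V\|h\|_{V'}$ for $v\in V,h\in H$. Notation: $\mathcal V=L_2((0,T);V)$, $\mathcal V'=L_2((0,T);V')$. Assumption (A): for every $U_0\in H$ and $F\in\mathcal V'$ there exists $U\in\mathcal V$ solving $\partial_tU(t)=\mathbf AU(t)+F(t)$, $U(0)=U_0$, and there is a constant $C(\mathbf A,T)$ such that every such solution satisfies $\|U\|_{\mathcal V}\le C(\mathbf A,T)(\|U_0\|_H+\|F\|_{\mathcal V'})$ (in particular the solution is unique). Solution: $u=\sum_\alpha u_\alpha\xi_\alpha\in\mathcal R L_2(\mathbb F;\mathcal V)$ is a solution of the equation if every $u_\alpha$ belongs to $\mathbf C([0,T];H)$ (after choice of a continuous version) and, in $V'$, for all $t\in[0,T]$ and $\alpha\in\mathcal J$, $$u_\alpha(t)=u_{0,\alpha}+\int_0^t\Big(\mathbf Au_\alpha(s)+f_\alpha(s)+\sum_{k\ge1}\sqrt{\alpha_k}\,\mathbf M_ku_{\alpha-\varepsilon_k}(s)\Big)ds,$$ where terms with $\alpha_k=0$ are zero. *)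

theory Defs
  imports "HOL-Probability.Probability" "HOL-Library.Poly_Mapping"
begin

section \<open>White noise and the chaos basis\<close>

definition centered_gaussian :: "'w measure \<Rightarrow> ('w \<Rightarrow> real) \<Rightarrow> bool" where
  "centered_gaussian P X \<longleftrightarrow> X \<in> borel_measurable P \<and>
     ((AE \<omega> in P. X \<omega> = 0) \<or> (\<exists>\<sigma>>0. distributed P lborel X (normal_density 0 \<sigma>)))"

text \<open>
  The basis vectors, the operators $M_k$ and the positions of a multi-index are numbered
  from 0 instead of 1. Since the measure is complete, it is the $\sigma$-algebra generated
  by the noise together with the null sets that has to be the whole one.
\<close>

locale white_noise = prob_space P + complete_measure P
  for P :: "'w measure"
    and \<uu> :: "nat \<Rightarrow> 'u :: {real_inner, complete_space}"
    and W :: "'u \<Rightarrow> 'w \<Rightarrow> real" +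
  assumes orthonormal: "\<uu> k \<bullet> \<uu> l = (if k = l then 1 else 0)"
    and total: "closure (span (range \<uu>)) = UNIV"
    and gaussian: "finite S \<Longrightarrow> centered_gaussian P (\<lambda>\<omega>. \<Sum>h\<in>S. c h * W h \<omega>)"
    and covariance: "expectation (\<lambda>\<omega>. W h\<^sub>1 \<omega> * W h\<^sub>2 \<omega>) = h\<^sub>1 \<bullet> h\<^sub>2"
    and generated: "sets P = sigma_sets (space P)
      ({W h -` B \<inter> space P | h B. B \<in> sets borel} \<union> null_sets P)"

type_synonym multi_index = "nat \<Rightarrow>\<^sub>0 nat"

definition hermite :: "nat \<Rightarrow> real \<Rightarrow> real" where
  "hermite n x = (-1) ^ n * exp (x\<^sup>2 / 2) * (deriv ^^ n) (\<lambda>y. exp (- y\<^sup>2 / 2)) x"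

definition chaos_basis ::
    "(nat \<Rightarrow> 'u) \<Rightarrow> ('u \<Rightarrow> 'w \<Rightarrow> real) \<Rightarrow> multi_index \<Rightarrow> 'w \<Rightarrow> real" where
  "chaos_basis \<uu> W \<alpha> \<omega> = (\<Prod>k\<in>Poly_Mapping.keys \<alpha>.
     hermite (Poly_Mapping.lookup \<alpha> k) (W (\<uu> k) \<omega>) / sqrt (fact (Poly_Mapping.lookup \<alpha> k)))"

section \<open>Strong measurability and the Bochner integral\<close>

text \<open>
  The library's Bochner integral requires a second-countable range type. The Hilbert spaces
  of a normal triple need not be separable, so the same construction is given here without
  that restriction.
\<close>

definition strongly_measurable :: "'a measure \<Rightarrow> ('a \<Rightarrow> 'x :: real_normed_vector) \<Rightarrow> bool" where
  "strongly_measurable M f \<longleftrightarrow>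
     (\<exists>s. (\<forall>n. simple_function M (s n)) \<and> (AE x in M. (\<lambda>n::nat. s n x) \<longlonglongrightarrow> f x))"

definition has_Bochner_integral ::
    "'a measure \<Rightarrow> ('a \<Rightarrow> 'x :: real_normed_vector) \<Rightarrow> 'x \<Rightarrow> bool" where
  "has_Bochner_integral M f I \<longleftrightarrow> strongly_measurable M f \<and>
     (\<exists>s. (\<forall>n. Bochner_Integration.simple_bochner_integrable M (s n)) \<and>
          (\<lambda>n::nat. \<integral>\<^sup>+x. ennreal (norm (f x - s n x)) \<partial>M) \<longlonglongrightarrow> 0 \<and>
          (\<lambda>n. Bochner_Integration.simple_bochner_integral M (s n)) \<longlonglongrightarrow> I)"

text \<open>
  The functions are representatives: elements of $L_2((0,T);X)$ are to be identified when
  they agree almost everywhere.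
\<close>

definition L2 :: "real \<Rightarrow> (real \<Rightarrow> 'x :: real_normed_vector) set" where
  "L2 T = {f. strongly_measurable (lebesgue_on {0<..<T}) f \<and>
              integrable (lebesgue_on {0<..<T}) (\<lambda>t. (norm (f t))\<^sup>2)}"

definition L2_norm :: "real \<Rightarrow> (real \<Rightarrow> 'x :: real_normed_vector) \<Rightarrow> real" where
  "L2_norm T f = sqrt (LINT t|lebesgue_on {0<..<T}. (norm (f t))\<^sup>2)"

section \<open>Weighted chaos spaces\<close>

definition bounded_weights :: "(multi_index \<Rightarrow> real) \<Rightarrow> bool" where
  "bounded_weights r \<longleftrightarrow> (\<forall>\<alpha>. 0 < r \<alpha>) \<and> (\<exists>B. \<forall>\<alpha>. r \<alpha> \<le> B)"

text \<open>
  A formal series $\sum_\alpha v_\alpha \xi_\alpha$ in the elements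
  $\xi_\alpha$ = \<^const>\<open>chaos_basis\<close> is represented by its family of coefficients.
  The coefficient space is given by its carrier and its norm, so that the definition covers
  both a Hilbert space and the space $L_2((0,T);X)$.
\<close>

definition RL2 ::
    "(multi_index \<Rightarrow> real) \<Rightarrow> 'x set \<Rightarrow> ('x \<Rightarrow> real) \<Rightarrow> (multi_index \<Rightarrow> 'x) set" where
  "RL2 r X nrm = {v. (\<forall>\<alpha>. v \<alpha> \<in> X) \<and> (\<lambda>\<alpha>. (r \<alpha>)\<^sup>2 * (nrm (v \<alpha>))\<^sup>2) summable_on UNIV}"

section \<open>Normal triples and the evolution equations\<close>

text \<open>
  The embeddings are the maps \<open>i\<close> and \<open>j\<close>. That $V'$ is the dual of $V$ relative to the
  inner product of $H$ means that $h \mapsto (h, \cdot)_H$ extends from $H$ to an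
  isomorphism \<open>D\<close> of $V'$ onto the space of continuous linear functionals on $V$.
\<close>

definition normal_triple ::
    "('v :: {real_inner, complete_space} \<Rightarrow> 'h :: {real_inner, complete_space}) \<Rightarrow>
     ('h \<Rightarrow> 'd :: {real_inner, complete_space}) \<Rightarrow> bool" where
  "normal_triple i j \<longleftrightarrow>
     bounded_linear i \<and> inj i \<and> closure (range i) = UNIV \<and>
     bounded_linear j \<and> inj j \<and> closure (range j) = UNIV \<and>
     (\<exists>D :: 'd \<Rightarrow> ('v \<Rightarrow>\<^sub>L real).
        bounded_linear D \<and> bij D \<and> bounded_linear (inv D) \<and>
        (\<forall>h v. blinfun_apply (D (j h)) v = h \<bullet> i v)) \<and>
     (\<exists>C. \<forall>v h. \<bar>h \<bullet> i v\<bar> \<le> C * norm v * norm (j h))"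

text \<open>
  The equation $\partial_t U = A U + F$, $U(0) = U_0$ in $V'$, for $U \in L_2((0,T);V)$:
  as $U$ is only given up to null sets, the integrated equation is required for almost
  every $t$, and no continuity in $H$ is presupposed.
\<close>

definition deterministic_solution ::
    "('v \<Rightarrow> 'h) \<Rightarrow> ('h \<Rightarrow> 'd) \<Rightarrow> ('v \<Rightarrow> 'd) \<Rightarrow> real \<Rightarrow>
     'h \<Rightarrow> (real \<Rightarrow> 'd :: real_normed_vector) \<Rightarrow> (real \<Rightarrow> 'v :: real_normed_vector) \<Rightarrow> bool" where
  "deterministic_solution i j A T U\<^sub>0 F U \<longleftrightarrow> U \<in> L2 T \<and>
     (AE t in lebesgue_on {0<..<T}.
        has_Bochner_integral (lebesgue_on {0<..<t}) (\<lambda>s. A (U s) + F s) (j (i (U t)) - j U\<^sub>0))"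

definition assumption_A ::
    "('v :: real_normed_vector \<Rightarrow> 'h :: real_normed_vector) \<Rightarrow>
     ('h \<Rightarrow> 'd :: real_normed_vector) \<Rightarrow> ('v \<Rightarrow> 'd) \<Rightarrow> real \<Rightarrow> bool" where
  "assumption_A i j A T \<longleftrightarrow>
     (\<forall>U\<^sub>0. \<forall>F\<in>L2 T. \<exists>U. deterministic_solution i j A T U\<^sub>0 F U) \<and>
     (\<exists>C. \<forall>U\<^sub>0. \<forall>F\<in>L2 T. \<forall>U. deterministic_solution i j A T U\<^sub>0 F U \<longrightarrow>
        L2_norm T U \<le> C * (norm U\<^sub>0 + L2_norm T F))"

text \<open>
  The sum is the coefficient of $\xi_\alpha$ in $\sum_k (M_k u) \diamond \xi_k$;
  the terms with $\alpha_k = 0$ are left out. \<open>U\<close> is the continuous version of $u_\alpha$.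
\<close>

definition chaos_solution ::
    "('v \<Rightarrow> 'h) \<Rightarrow> ('h \<Rightarrow> 'd) \<Rightarrow> ('v \<Rightarrow> 'd) \<Rightarrow> (nat \<Rightarrow> 'v \<Rightarrow> 'd) \<Rightarrow> real \<Rightarrow>
     (multi_index \<Rightarrow> 'h :: real_normed_vector) \<Rightarrow>
     (multi_index \<Rightarrow> real \<Rightarrow> 'd :: real_normed_vector) \<Rightarrow>
     (multi_index \<Rightarrow> real \<Rightarrow> 'v :: real_normed_vector) \<Rightarrow> bool" where
  "chaos_solution i j A M T u\<^sub>0 f u \<longleftrightarrow>
     (\<forall>\<alpha>. \<exists>U :: real \<Rightarrow> 'h.
        continuous_on {0..T} U \<and>
        (AE t in lebesgue_on {0<..<T}. U t = i (u \<alpha> t)) \<and>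
        (\<forall>t\<in>{0..T}. has_Bochner_integral (lebesgue_on {0<..<t})
           (\<lambda>s. A (u \<alpha> s) + f \<alpha> s +
              (\<Sum>k\<in>Poly_Mapping.keys \<alpha>. sqrt (real (Poly_Mapping.lookup \<alpha> k)) *\<^sub>R
                 M k (u (\<alpha> - Poly_Mapping.single k 1) s)))
           (j (U t) - j (u\<^sub>0 \<alpha>))))"

end

theory Submission
  imports Defs
begin

text \<open>
  The equation for $u_\alpha$ involves only $u_\alpha$ and the coefficients $u_{\alpha - \varepsilon_k}$
  of smaller order, so assumption (A) determines the coefficients one after the other. As there are
  only countably many of them, weights that decrease fast enough make any such family an element of the
  weighted space. What remains is that $u \in L_2((0,T);V)$ with derivative $g \in L_2((0,T);V')$ has
  a version that is continuous in $H$. On the set $G$ of full measure where the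
  integrated equation holds, the pairing inequality of the triple gives
  $|(u(b) - u(a), u(c))_H| \le \Lambda(b) - \Lambda(a) + (b - a) \|u(c)\|_V^2$ with
  $\Lambda$ the integral of $\|u\|_V^2 + K^2 \|g\|_{V'}^2$. This implies
  $\|u(t) - u(s)\|_H^2 \le 48 (\Lambda(t) - \Lambda(s))$ on $G$, so $u$ is uniformly continuous
  there and extends to the closure of $G$.
\<close>

section \<open>Strong measurability and the Bochner integral\<close>

text \<open>The difficulty behind the continuous version is that the pairing inequality carries
  ||u(c)||_V^2, which is finite at every time c but admits no bound uniform in c. Intermediate times
  are therefore chosen where this quantity is at most its mean over an interval comparable in length
  to the time step; its product with the step is then absorbed by an increment of \<Lambda>, and
  such increments add up along a chain of times. No bound of this kind is available at the end time
  of the chain, so that time is reached as a limit, where the uncontrolled value is fixed and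
  multiplied by a length tending to 0.

  The norms of the operators M_k may grow arbitrarily with k. The weights are therefore chosen only
  after all coefficients are known, and uniqueness is proved coefficient by coefficient, so that it
  holds whatever the weights are.\<close>

lemma (in complete_measure) borel_measurable_cong_AE:
  assumes f: "f \<in> borel_measurable M" and ae: "AE x in M. f x = g x"
  shows "g \<in> borel_measurable M"
proof (rule measurableI)
  fix A :: "'b set" assume A: "A \<in> sets borel"
  show "g -` A \<inter> space M \<in> sets M"
  proof (rule in_sets_AE)
    show "f -` A \<inter> space M \<in> sets M"
      using f A by (rule measurable_sets)
    show "AE x in M. (x \<in> f -` A \<inter> space M) \<longleftrightarrow> (x \<in> g -` A \<inter> space M)"
      using ae by eventually_elim auto
  qed auto
qed auto

lemma complete_measure_lebesgue_on:
  assumes "S \<in> sets lebesgue"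
  shows "complete_measure (lebesgue_on S)"
proof
  fix A B :: "'a set" assume "B \<subseteq> A" "A \<in> null_sets (lebesgue_on S)"
  then show "B \<in> sets (lebesgue_on S)"
    using assms completion.complete2[of B A lborel]
    by (auto simp: null_sets_restrict_space sets_restrict_space_iff)
qed

lemma finite_measure_lebesgue_on_Ioo: "finite_measure (lebesgue_on {a<..<b::real})"
proof
  have "emeasure lborel {a<..<b} \<noteq> \<infinity>"
    by (cases "a \<le> b") (auto simp: emeasure_lborel_Ioo)
  then show "emeasure (lebesgue_on {a<..<b}) (space (lebesgue_on {a<..<b})) \<noteq> \<infinity>"
    by (simp add: emeasure_restrict_space)
qed

text \<open>Sequential continuity of \<open>h\<close> passes almost everywhere convergence of the
  approximants through \<open>h\<close>. Sums, differences, bounded linear images and norms are all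
  instances; a unary map is given as a function that ignores its second argument.\<close>

lemma strongly_measurable_compose2:
  assumes f: "strongly_measurable M f" and g: "strongly_measurable M g"
    and h: "\<And>X Y x y. X \<longlonglongrightarrow> x \<Longrightarrow> Y \<longlonglongrightarrow> y \<Longrightarrow> (\<lambda>n. h (X n) (Y n)) \<longlonglongrightarrow> h x y"
  shows "strongly_measurable M (\<lambda>x. h (f x) (g x))"
proof -
  obtain s where s: "\<And>n. simple_function M (s n)" "AE x in M. (\<lambda>n. s n x) \<longlonglongrightarrow> f x"
    using f unfolding strongly_measurable_def by blast
  obtain t where t: "\<And>n. simple_function M (t n)" "AE x in M. (\<lambda>n. t n x) \<longlonglongrightarrow> g x"
    using g unfolding strongly_measurable_def by blast
  show ?thesis
    unfolding strongly_measurable_def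
  proof (intro exI conjI allI)
    show "simple_function M (\<lambda>x. h (s n x) (t n x))" for n
      using s(1) t(1) by (rule simple_function_compose2)
    show "AE x in M. (\<lambda>n. h (s n x) (t n x)) \<longlonglongrightarrow> h (f x) (g x)"
      using s(2) t(2) by eventually_elim (rule h)
  qed
qed

lemma strongly_measurable_add:
  "strongly_measurable M f \<Longrightarrow> strongly_measurable M g \<Longrightarrow> strongly_measurable M (\<lambda>x. f x + g x)"
  by (rule strongly_measurable_compose2[where h = "(+)"]) (auto intro: tendsto_add)

lemma strongly_measurable_diff:
  "strongly_measurable M f \<Longrightarrow> strongly_measurable M g \<Longrightarrow> strongly_measurable M (\<lambda>x. f x - g x)"
  by (rule strongly_measurable_compose2[where h = "(-)"]) (auto intro: tendsto_diff)

lemma strongly_measurable_bounded_linear: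
  assumes "strongly_measurable M f" "bounded_linear h"
  shows "strongly_measurable M (\<lambda>x. h (f x))"
  by (rule strongly_measurable_compose2[OF assms(1,1), where h = "\<lambda>x _. h x"])
    (rule bounded_linear.tendsto[OF assms(2)])

lemma strongly_measurable_zero: "strongly_measurable M (\<lambda>x. 0)"
  unfolding strongly_measurable_def by (intro exI[of _ "\<lambda>n x. 0"]) auto

lemma AE_lebesgue_on_subset:
  fixes S T :: "'a::euclidean_space set"
  assumes "AE x in lebesgue_on S. Q x" "T \<subseteq> S" "S \<in> sets lebesgue" "T \<in> sets lebesgue"
  shows "AE x in lebesgue_on T. Q x"
proof -
  have "AE x in lebesgue. x \<in> S \<longrightarrow> Q x"
    using assms(1,3) by (simp add: AE_restrict_space_iff)
  then have "AE x in lebesgue. x \<in> T \<longrightarrow> Q x"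
    by eventually_elim (use assms(2) in auto)
  then show ?thesis
    using assms(4) by (simp add: AE_restrict_space_iff)
qed

lemma strongly_measurable_lebesgue_on_subset:
  fixes f :: "'a::euclidean_space \<Rightarrow> _"
  assumes "strongly_measurable (lebesgue_on S) f" and ST: "T \<subseteq> S" "S \<in> sets lebesgue" "T \<in> sets lebesgue"
  shows "strongly_measurable (lebesgue_on T) f"
proof -
  obtain s where s: "\<And>n. simple_function (lebesgue_on S) (s n)"
      "AE x in lebesgue_on S. (\<lambda>n. s n x) \<longlonglongrightarrow> f x"
    using assms unfolding strongly_measurable_def by blast
  have "simple_function (lebesgue_on T) (s n)" for n
  proof -
    have "finite (s n ` T)"
      using s(1)[of n] ST by (auto simp: simple_function_def intro: finite_subset[of _ "s n ` S"])
    moreover have "s n -` {y} \<inter> T \<in> sets (lebesgue_on T)" if "y \<in> s n ` T" for y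
    proof -
      have "s n -` {y} \<inter> S \<in> sets (lebesgue_on S)"
        using s(1)[of n] ST that by (auto simp: simple_function_def)
      then have "s n -` {y} \<inter> S \<in> sets lebesgue"
        using ST by (simp add: sets_restrict_space_iff)
      then have "s n -` {y} \<inter> S \<inter> T \<in> sets lebesgue"
        using ST by auto
      moreover have "s n -` {y} \<inter> S \<inter> T = s n -` {y} \<inter> T"
        using ST by auto
      ultimately show ?thesis
        using ST by (simp add: sets_restrict_space_iff)
    qed
    ultimately show ?thesis
      by (auto simp: simple_function_def)
  qed
  then show ?thesis
    using AE_lebesgue_on_subset[OF s(2) ST] unfolding strongly_measurable_def by blast
qed

text \<open>The approximants converge only almost everywhere. Their \<open>lim\<close> is measurable
  everywhere, and completeness carries measurability over to a function that agrees with it outside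
  a null set.\<close>

lemma (in complete_measure) strongly_measurable_real:
  fixes f :: "'a \<Rightarrow> real"
  assumes "strongly_measurable M f"
  shows "f \<in> borel_measurable M"
proof -
  obtain s where s: "\<And>n. simple_function M (s n)" "AE x in M. (\<lambda>n. s n x) \<longlonglongrightarrow> f x"
    using assms unfolding strongly_measurable_def by blast
  have "s n \<in> borel_measurable M" for n
    using s(1) by (rule borel_measurable_simple_function)
  then have "(\<lambda>x. lim (\<lambda>n. s n x)) \<in> borel_measurable M"
    by (rule borel_measurable_lim_metric)
  moreover have "AE x in M. lim (\<lambda>n. s n x) = f x"
    using s(2) by eventually_elim (rule limI)
  ultimately show ?thesis
    by (rule borel_measurable_cong_AE)
qed

lemma (in complete_measure) strongly_measurable_norm:
  assumes "strongly_measurable M f"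
  shows "(\<lambda>x. norm (f x)) \<in> borel_measurable M"
  by (intro strongly_measurable_real
      strongly_measurable_compose2[OF assms assms, where h = "\<lambda>x _. norm x"] tendsto_norm)

lemma (in complete_measure) strongly_measurable_inner:
  fixes f :: "'a \<Rightarrow> 'x::real_inner"
  assumes "strongly_measurable M f"
  shows "(\<lambda>x. f x \<bullet> y) \<in> borel_measurable M"
  by (intro strongly_measurable_real strongly_measurable_bounded_linear[OF assms]
      bounded_linear_inner_left)

lemma simple_function_strongly_measurable:
  "simple_function M s \<Longrightarrow> strongly_measurable M s"
  unfolding strongly_measurable_def by (intro exI[of _ "\<lambda>n. s"]) auto

section \<open>Existence of Bochner integrals and their identification by test vectors\<close>

lemma simple_bochner_integral_norm_diff_le:
  fixes s t :: "'a \<Rightarrow> 'x::real_normed_vector"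
  assumes s: "Bochner_Integration.simple_bochner_integrable M s"
    and t: "Bochner_Integration.simple_bochner_integrable M t"
  shows "ennreal (norm (Bochner_Integration.simple_bochner_integral M s -
      Bochner_Integration.simple_bochner_integral M t)) \<le> (\<integral>\<^sup>+x. norm (s x - t x) \<partial>M)"
proof -
  have "ennreal (norm (Bochner_Integration.simple_bochner_integral M s -
      Bochner_Integration.simple_bochner_integral M t)) =
      norm (Bochner_Integration.simple_bochner_integral M (\<lambda>x. s x - t x))"
    using s t by (subst simple_bochner_integral_diff) auto
  also have "\<dots> \<le> Bochner_Integration.simple_bochner_integral M (\<lambda>x. norm (s x - t x))"
    using simple_bochner_integrable_compose2[of "(-)" M "s" "t"] s t
    by (auto intro!: simple_bochner_integral_norm_bound)
  also have "\<dots> = (\<integral>\<^sup>+x. norm (s x - t x) \<partial>M)"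
    using simple_bochner_integrable_compose2[of "\<lambda>x y. norm (x - y)" M "s" "t"] s t
    by (auto intro!: simple_bochner_integral_eq_nn_integral)
  finally show ?thesis .
qed

text \<open>Strong measurability provides approximants without any integrable bound. Truncation
  makes them dominated by a multiple of \<open>norm (f x)\<close>; dominated convergence then gives
  convergence in mean, so their integrals form a Cauchy sequence in a complete space.\<close>

lemma (in complete_measure) has_Bochner_integral_exists:
  fixes f :: "'a \<Rightarrow> 'x::{real_normed_vector, complete_space}"
  assumes f: "strongly_measurable M f" and int: "integrable M (\<lambda>x. norm (f x))"
  shows "\<exists>I. has_Bochner_integral M f I"
proof -
  obtain s where s: "\<And>n. simple_function M (s n)" "AE x in M. (\<lambda>n. s n x) \<longlonglongrightarrow> f x"
    using f unfolding strongly_measurable_def by blast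
  note [measurable] = strongly_measurable_norm[OF f]
  have [measurable]: "(\<lambda>x. norm (s n x)) \<in> borel_measurable M" for n
    by (rule strongly_measurable_norm[OF simple_function_strongly_measurable[OF s(1)]])
  \<comment> \<open>The factor 2 leaves room above \<open>norm (f x)\<close>: where
    \<open>f x\<close> is nonzero, the approximants eventually satisfy the bound and are kept; where
    \<open>f x = 0\<close>, the truncated values are 0, which is the right limit.\<close>
  define B where "B n = {x \<in> space M. norm (s n x) \<le> 2 * norm (f x)}" for n
  have [measurable]: "B n \<in> sets M" for n
    unfolding B_def by measurable
  define t where "t n x = indicat_real (B n) x *\<^sub>R s n x" for n x
  have t: "simple_function M (t n)" for n
    unfolding t_def[abs_def] by (intro simple_function_compose2[where h = "(*\<^sub>R)"] simple_function_indicator s(1)) measurable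
  have t_le: "norm (t n x) \<le> 2 * norm (f x)" for n x
    by (auto simp: t_def B_def indicator_def)
  have t_lim: "AE x in M. (\<lambda>n. t n x) \<longlonglongrightarrow> f x"
    using s(2) AE_space
  proof eventually_elim
    case (elim x)
    show ?case
    proof (cases "f x = 0")
      case True
      then have "t n x = 0" for n
        using t_le[of n x] by simp
      with True show ?thesis by simp
    next
      case False
      then have "norm (f x) < 2 * norm (f x)" by simp
      then have "eventually (\<lambda>n. norm (s n x) < 2 * norm (f x)) sequentially"
        by (rule order_tendstoD(2)[OF tendsto_norm[OF elim(1)]])
      then have "eventually (\<lambda>n. s n x = t n x) sequentially"
        by eventually_elim (use elim in \<open>auto simp: t_def B_def\<close>)
      then show ?thesis
        using elim(1) by (rule Lim_transform_eventually[rotated])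
    qed
  qed
  have m: "(\<lambda>x. norm (f x - t n x)) \<in> borel_measurable M" for n
    by (rule strongly_measurable_norm[OF strongly_measurable_diff[OF f simple_function_strongly_measurable[OF t]]])
  have bd: "norm (norm (f x - t n x)) \<le> 3 * norm (f x)" for n x
    using t_le[of n x] norm_triangle_ineq4[of "f x" "t n x"] by simp
  have I0: "(\<lambda>n. LINT x|M. norm (f x - t n x)) \<longlonglongrightarrow> (LINT x|M. 0)"
  proof (rule integral_dominated_convergence[where w = "\<lambda>x. 3 * norm (f x)"])
    show "AE x in M. (\<lambda>n. norm (f x - t n x)) \<longlonglongrightarrow> 0"
      using t_lim
    proof eventually_elim
      case (elim x)
      have "(\<lambda>n. norm (f x - t n x)) \<longlonglongrightarrow> norm (f x - f x)"
        by (intro tendsto_intros elim)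
      then show ?case by simp
    qed
    show "AE x in M. norm (norm (f x - t n x)) \<le> 3 * norm (f x)" for n
      by (intro AE_I2 bd)
  qed (use m int in auto)
  have int': "integrable M (\<lambda>x. norm (f x - t n x))" for n
    by (rule Bochner_Integration.integrable_bound[where f = "\<lambda>x. 3 * norm (f x)", OF _ m])
      (use int bd in \<open>auto intro!: AE_I2\<close>)
  have nn: "(\<integral>\<^sup>+x. norm (f x - t n x) \<partial>M) = ennreal (LINT x|M. norm (f x - t n x))" for n
    by (intro nn_integral_eq_integral int') auto
  have L: "(\<lambda>n. \<integral>\<^sup>+x. norm (f x - t n x) \<partial>M) \<longlonglongrightarrow> 0"
    unfolding nn using tendsto_ennrealI[OF I0] by simp
  have tb: "Bochner_Integration.simple_bochner_integrable M (t n)" for n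
  proof (rule simple_bochner_integrableI_bounded[OF t])
    have "(\<integral>\<^sup>+x. norm (t n x) \<partial>M) \<le> (\<integral>\<^sup>+x. 2 * norm (f x) \<partial>M)"
      by (intro nn_integral_mono ennreal_leI t_le)
    also have "\<dots> < \<infinity>"
      using int integrableD(2)[of M "\<lambda>x. 2 * norm (f x)"] by (auto simp: less_top)
    finally show "(\<integral>\<^sup>+x. norm (t n x) \<partial>M) < \<infinity>" .
  qed
  define J where "J n = Bochner_Integration.simple_bochner_integral M (t n)" for n
  define e where "e n = (LINT x|M. norm (f x - t n x))" for n
  have e0: "0 \<le> e n" for n unfolding e_def by simp
  have Jd: "norm (J m - J n) \<le> e m + e n" for m n
  proof -
    have "ennreal (norm (J m - J n)) \<le> (\<integral>\<^sup>+x. norm (t m x - t n x) \<partial>M)"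
      unfolding J_def by (intro simple_bochner_integral_norm_diff_le tb)
    also have "\<dots> \<le> (\<integral>\<^sup>+x. norm (f x - t m x) + norm (f x - t n x) \<partial>M)"
    proof (intro nn_integral_mono ennreal_leI)
      show "norm (t m x - t n x) \<le> norm (f x - t m x) + norm (f x - t n x)" for x
        using norm_triangle_ineq4[of "f x - t n x" "f x - t m x"] by simp
    qed
    also have "\<dots> = ennreal (LINT x|M. norm (f x - t m x) + norm (f x - t n x))"
      by (intro nn_integral_eq_integral Bochner_Integration.integrable_add int') auto
    also have "\<dots> = ennreal (e m + e n)"
      unfolding e_def by (simp add: int')
    finally show ?thesis
      using e0[of m] e0[of n] by (subst (asm) ennreal_le_iff) auto
  qed
  have "Cauchy J"
  proof (rule CauchyI)
    fix r :: real assume "0 < r"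
    moreover have "e \<longlonglongrightarrow> 0" using I0 by (simp add: e_def[abs_def])
    ultimately have "eventually (\<lambda>n. e n < r / 2) sequentially"
      by (intro order_tendstoD(2)) auto
    then obtain N where N: "\<And>n. n \<ge> N \<Longrightarrow> e n < r / 2"
      by (auto simp: eventually_sequentially)
    have "norm (J m - J n) < r" if "m \<ge> N" "n \<ge> N" for m n
      using Jd[of m n] N[OF that(1)] N[OF that(2)] by linarith
    then show "\<exists>N. \<forall>m\<ge>N. \<forall>n\<ge>N. norm (J m - J n) < r" by blast
  qed
  then obtain I where "J \<longlonglongrightarrow> I"
    using Cauchy_convergent by (auto simp: convergent_def)
  with f tb L show ?thesis
    unfolding has_Bochner_integral_def J_def by blast
qed

text \<open>Pairing with a fixed \<open>y\<close> commutes with integrals of simple functions and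
  changes the error by at most the factor \<open>norm y\<close>, so the same approximants witness a
  real Bochner integral.\<close>

lemma (in complete_measure) has_Bochner_integral_D:
  fixes f :: "'a \<Rightarrow> 'x::real_inner"
  assumes "has_Bochner_integral M f I"
  shows "integrable M (\<lambda>x. norm (f x))" "(LINT x|M. f x \<bullet> y) = I \<bullet> y"
proof -
  obtain s where f: "strongly_measurable M f"
    and s: "\<And>n. Bochner_Integration.simple_bochner_integrable M (s n)"
    and lim: "(\<lambda>n. \<integral>\<^sup>+x. ennreal (norm (f x - s n x)) \<partial>M) \<longlonglongrightarrow> 0"
    and I: "(\<lambda>n. Bochner_Integration.simple_bochner_integral M (s n)) \<longlonglongrightarrow> I"
    using assms unfolding has_Bochner_integral_def by blast
  have ss: "strongly_measurable M (s n)" for n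
    using s[of n] by (auto elim!: simple_bochner_integrable.cases intro: simple_function_strongly_measurable)
  note [measurable] = strongly_measurable_norm[OF f] strongly_measurable_norm[OF ss]
    strongly_measurable_norm[OF strongly_measurable_diff[OF f ss]]
  show "integrable M (\<lambda>x. norm (f x))"
  proof (rule integrableI_bounded)
    have "eventually (\<lambda>n. (\<integral>\<^sup>+x. ennreal (norm (f x - s n x)) \<partial>M) < 1) sequentially"
      by (rule order_tendstoD(2)[OF lim]) simp
    then obtain n where n: "(\<integral>\<^sup>+x. ennreal (norm (f x - s n x)) \<partial>M) < 1"
      by (auto simp: eventually_sequentially)
    have "Bochner_Integration.simple_bochner_integrable M (\<lambda>x. norm (s n x))"
      using simple_bochner_integrable_compose2[of "\<lambda>x y. norm x" M "s n" "s n"] s by auto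
    then have "(\<integral>\<^sup>+x. norm (s n x) \<partial>M) = ennreal (Bochner_Integration.simple_bochner_integral M (\<lambda>x. norm (s n x)))"
      by (intro simple_bochner_integral_eq_nn_integral[symmetric]) auto
    then have sf: "(\<integral>\<^sup>+x. norm (s n x) \<partial>M) < \<infinity>" by simp
    have "(\<integral>\<^sup>+x. norm (f x) \<partial>M) \<le> (\<integral>\<^sup>+x. ennreal (norm (f x - s n x)) + ennreal (norm (s n x)) \<partial>M)"
      by (intro nn_integral_mono)
        (simp add: ennreal_plus[symmetric] norm_triangle_sub add.commute del: ennreal_plus)
    also have "\<dots> = (\<integral>\<^sup>+x. ennreal (norm (f x - s n x)) \<partial>M) + (\<integral>\<^sup>+x. ennreal (norm (s n x)) \<partial>M)"
      by (intro nn_integral_add) auto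
    also have "\<dots> < \<infinity>"
      using n sf by (auto simp: less_top[symmetric])
    finally show "(\<integral>\<^sup>+x. ennreal (norm (norm (f x))) \<partial>M) < \<infinity>" by simp
  qed simp
  have bl: "bounded_linear (\<lambda>v. v \<bullet> y)" by (rule bounded_linear_inner_left)
  have "has_bochner_integral M (\<lambda>x. f x \<bullet> y) (I \<bullet> y)"
  proof (rule has_bochner_integral.intros)
    show "(\<lambda>x. f x \<bullet> y) \<in> borel_measurable M"
      by (rule strongly_measurable_inner[OF f])
    show "Bochner_Integration.simple_bochner_integrable M (\<lambda>x. s n x \<bullet> y)" for n
      using simple_bochner_integrable_compose2[of "\<lambda>x _. x \<bullet> y" M "s n" "s n"] s by auto
    show "(\<lambda>n. \<integral>\<^sup>+x. ennreal (norm (f x \<bullet> y - s n x \<bullet> y)) \<partial>M) \<longlonglongrightarrow> 0"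
    proof (rule tendsto_sandwich[OF _ _ tendsto_const])
      have "(\<integral>\<^sup>+x. ennreal (norm (f x \<bullet> y - s n x \<bullet> y)) \<partial>M)
          \<le> norm y * (\<integral>\<^sup>+x. ennreal (norm (f x - s n x)) \<partial>M)" for n
      proof -
        have "(\<integral>\<^sup>+x. ennreal (norm (f x \<bullet> y - s n x \<bullet> y)) \<partial>M)
          \<le> (\<integral>\<^sup>+x. ennreal (norm y) * ennreal (norm (f x - s n x)) \<partial>M)"
          by (intro nn_integral_mono)
            (auto simp: inner_diff_left[symmetric] ennreal_mult[symmetric] mult.commute
               intro!: ennreal_leI Cauchy_Schwarz_ineq2[THEN order_trans])
        also have "\<dots> = norm y * (\<integral>\<^sup>+x. ennreal (norm (f x - s n x)) \<partial>M)"
          by (intro nn_integral_cmult) auto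
        finally show ?thesis .
      qed
      then show "eventually (\<lambda>n. (\<integral>\<^sup>+x. ennreal (norm (f x \<bullet> y - s n x \<bullet> y)) \<partial>M)
          \<le> norm y * (\<integral>\<^sup>+x. ennreal (norm (f x - s n x)) \<partial>M)) sequentially"
        by (intro always_eventually) auto
      have "(\<lambda>n. norm y * (\<integral>\<^sup>+x. ennreal (norm (f x - s n x)) \<partial>M)) \<longlonglongrightarrow> ennreal (norm y) * 0"
        by (intro ennreal_tendsto_cmult lim) auto
      then show "(\<lambda>n. norm y * (\<integral>\<^sup>+x. ennreal (norm (f x - s n x)) \<partial>M)) \<longlonglongrightarrow> 0" by simp
    qed auto
    have "Bochner_Integration.simple_bochner_integral M (\<lambda>x. s n x \<bullet> y) =
        Bochner_Integration.simple_bochner_integral M (s n) \<bullet> y" for n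
      by (intro simple_bochner_integral_linear bounded_linear.linear bl s)
    then show "(\<lambda>n. Bochner_Integration.simple_bochner_integral M (\<lambda>x. s n x \<bullet> y)) \<longlonglongrightarrow> I \<bullet> y"
      by (simp add: tendsto_intros I)
  qed
  then show "(LINT x|M. f x \<bullet> y) = I \<bullet> y"
    by (rule has_bochner_integral_integral_eq)
qed

lemma (in complete_measure) has_Bochner_integral_unique:
  fixes g :: "'a \<Rightarrow> 'x::real_inner"
  assumes "has_Bochner_integral M g I" "has_Bochner_integral M g J"
  shows "I = J"
proof -
  have "(I - J) \<bullet> (I - J) = 0"
    using has_Bochner_integral_D(2)[OF assms(1), of "I - J"]
      has_Bochner_integral_D(2)[OF assms(2), of "I - J"] by (simp add: inner_diff_left)
  then show ?thesis by simp
qed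

text \<open>An integral exists by norm integrability alone, so the test vectors only have to
  identify its value. In this weak form, linearity follows from linearity of real integrals.\<close>

lemma (in complete_measure) has_Bochner_integral_iff:
  fixes f :: "'a \<Rightarrow> 'x::{real_inner, complete_space}"
  shows "has_Bochner_integral M f I \<longleftrightarrow> strongly_measurable M f \<and>
    integrable M (\<lambda>x. norm (f x)) \<and> (\<forall>y. (LINT x|M. f x \<bullet> y) = I \<bullet> y)" (is "?L \<longleftrightarrow> ?R")
proof
  assume ?L
  then show ?R
    using has_Bochner_integral_D[of f I] by (auto simp: has_Bochner_integral_def)
next
  assume R: ?R
  then obtain J where J: "has_Bochner_integral M f J"
    using has_Bochner_integral_exists[of f] by blast
  have "(I - J) \<bullet> (I - J) = 0"
    using R has_Bochner_integral_D(2)[OF J, of "I - J"] by (simp add: inner_diff_left)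
  then show ?L using J by simp
qed

lemma (in complete_measure) has_Bochner_integral_diff:
  fixes f g :: "'a \<Rightarrow> 'x::{real_inner, complete_space}"
  assumes "has_Bochner_integral M f I" "has_Bochner_integral M g J"
  shows "has_Bochner_integral M (\<lambda>x. f x - g x) (I - J)"
proof -
  have sm: "strongly_measurable M f" "strongly_measurable M g"
    and int: "integrable M (\<lambda>x. norm (f x))" "integrable M (\<lambda>x. norm (g x))"
    and eq: "\<And>y. (LINT x|M. f x \<bullet> y) = I \<bullet> y" "\<And>y. (LINT x|M. g x \<bullet> y) = J \<bullet> y"
    using assms by (auto simp: has_Bochner_integral_iff)
  note smd = strongly_measurable_diff[OF sm]
  have "integrable M (\<lambda>x. norm (f x - g x))"
    by (rule Bochner_Integration.integrable_bound[OF Bochner_Integration.integrable_add[OF int]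
          strongly_measurable_norm[OF smd]])
      (auto intro!: AE_I2 norm_triangle_ineq4)
  moreover have inner: "integrable M (\<lambda>x. h x \<bullet> y)"
    if h: "strongly_measurable M h" "integrable M (\<lambda>x. norm (h x))" for h :: "'a \<Rightarrow> 'x" and y
  proof (rule Bochner_Integration.integrable_bound[OF _ strongly_measurable_inner[OF h(1)]])
    show "integrable M (\<lambda>x. norm (h x) * norm y)" using h(2) by simp
    show "AE x in M. norm (h x \<bullet> y) \<le> norm (norm (h x) * norm y)"
      by (intro AE_I2) (simp add: Cauchy_Schwarz_ineq2)
  qed
  have "(LINT x|M. (f x - g x) \<bullet> y) = (I - J) \<bullet> y" for y
    using inner[OF sm(1) int(1), of y] inner[OF sm(2) int(2), of y]
    by (simp add: inner_diff_left eq)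
  ultimately show ?thesis using smd by (simp add: has_Bochner_integral_iff)
qed

section \<open>Square integrable functions\<close>

lemma complete_measure_Ioo: "complete_measure (lebesgue_on {a<..<b::real})"
  by (rule complete_measure_lebesgue_on) simp

lemma L2_add:
  assumes "f \<in> L2 T" "g \<in> L2 T"
  shows "(\<lambda>t. f t + g t) \<in> L2 T"
proof -
  interpret complete_measure "lebesgue_on {0<..<T}" by (rule complete_measure_Ioo)
  have sm: "strongly_measurable (lebesgue_on {0<..<T}) (\<lambda>t. f t + g t)"
    using assms by (auto simp: L2_def intro: strongly_measurable_add)
  note [measurable] = strongly_measurable_norm[OF sm]
  have "integrable (lebesgue_on {0<..<T}) (\<lambda>t. (norm (f t + g t))\<^sup>2)"
  proof (rule Bochner_Integration.integrable_bound)
    show "integrable (lebesgue_on {0<..<T}) (\<lambda>t. 2 * (norm (f t))\<^sup>2 + 2 * (norm (g t))\<^sup>2)"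
      using assms by (auto simp: L2_def)
    have "(norm (f t + g t))\<^sup>2 \<le> 2 * (norm (f t))\<^sup>2 + 2 * (norm (g t))\<^sup>2" for t
    proof -
      have "(norm (f t + g t))\<^sup>2 \<le> (norm (f t) + norm (g t))\<^sup>2"
        by (intro power_mono norm_triangle_ineq) auto
      also have "\<dots> \<le> 2 * (norm (f t))\<^sup>2 + 2 * (norm (g t))\<^sup>2"
        using sum_squares_bound[of "norm (f t)" "norm (g t)"] by (simp add: power2_sum)
      finally show ?thesis .
    qed
    then show "AE t in lebesgue_on {0<..<T}. norm ((norm (f t + g t))\<^sup>2)
        \<le> norm (2 * (norm (f t))\<^sup>2 + 2 * (norm (g t))\<^sup>2)"
      by (intro AE_I2) simp
  qed measurable
  with sm show ?thesis by (simp add: L2_def)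
qed

lemma L2_bounded_linear:
  assumes "f \<in> L2 T" "bounded_linear h"
  shows "(\<lambda>t. h (f t)) \<in> L2 T"
proof -
  interpret complete_measure "lebesgue_on {0<..<T}" by (rule complete_measure_Ioo)
  have sm: "strongly_measurable (lebesgue_on {0<..<T}) (\<lambda>t. h (f t))"
    using assms by (auto simp: L2_def intro: strongly_measurable_bounded_linear)
  note [measurable] = strongly_measurable_norm[OF sm]
  obtain K where K: "\<And>x. norm (h x) \<le> norm x * K"
    using bounded_linear.bounded[OF assms(2)] by blast
  have "integrable (lebesgue_on {0<..<T}) (\<lambda>t. (norm (h (f t)))\<^sup>2)"
  proof (rule Bochner_Integration.integrable_bound)
    show "integrable (lebesgue_on {0<..<T}) (\<lambda>t. (norm (f t))\<^sup>2 * K\<^sup>2)"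
      using assms by (auto simp: L2_def)
    have "(norm (h (f t)))\<^sup>2 \<le> (norm (f t))\<^sup>2 * K\<^sup>2" for t
      using power_mono[OF K[of "f t"], of 2] by (simp add: power_mult_distrib)
    then show "AE t in lebesgue_on {0<..<T}. norm ((norm (h (f t)))\<^sup>2) \<le> norm ((norm (f t))\<^sup>2 * K\<^sup>2)"
      by (intro AE_I2) simp
  qed measurable
  with sm show ?thesis by (simp add: L2_def)
qed

lemma L2_zero: "(\<lambda>t. 0) \<in> L2 T"
  by (simp add: L2_def strongly_measurable_zero)

lemma L2_sum:
  "(\<And>k. k \<in> S \<Longrightarrow> f k \<in> L2 T) \<Longrightarrow> (\<lambda>t. \<Sum>k\<in>S. f k t) \<in> L2 T"
  by (induction S rule: infinite_finite_induct) (auto simp: L2_zero intro!: L2_add)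

lemma L2_scaleR: "f \<in> L2 T \<Longrightarrow> (\<lambda>t. c *\<^sub>R f t) \<in> L2 T"
  by (rule L2_bounded_linear) (auto intro: bounded_linear_scaleR_right)

lemma L2_diff:
  assumes "f \<in> L2 T" "g \<in> L2 T"
  shows "(\<lambda>t. f t - g t) \<in> L2 T"
  using L2_add[OF assms(1) L2_scaleR[OF assms(2), of "-1"]] by simp

lemma L2_norm_nonneg: "0 \<le> L2_norm T f"
  by (simp add: L2_norm_def)

text \<open>The form with \<open>\<le> 0\<close> matches what the a priori estimate delivers for
  vanishing data.\<close>

lemma L2_norm_le_zero_iff:
  assumes "f \<in> L2 T"
  shows "L2_norm T f \<le> 0 \<longleftrightarrow> (AE t in lebesgue_on {0<..<T}. f t = 0)"
proof -
  have "L2_norm T f \<le> 0 \<longleftrightarrow> (LINT t|lebesgue_on {0<..<T}. (norm (f t))\<^sup>2) = 0"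
  proof -
    have "0 \<le> (LINT t|lebesgue_on {0<..<T}. (norm (f t))\<^sup>2)" by simp
    then show ?thesis unfolding L2_norm_def by (simp only: real_sqrt_le_0_iff) linarith
  qed
  also have "\<dots> \<longleftrightarrow> (AE t in lebesgue_on {0<..<T}. (norm (f t))\<^sup>2 = 0)"
    using assms by (intro integral_nonneg_eq_0_iff_AE) (auto simp: L2_def)
  finally show ?thesis by simp
qed

lemma L2_integrable_norm:
  assumes "f \<in> L2 T"
  shows "integrable (lebesgue_on {0<..<T}) (\<lambda>t. norm (f t))"
proof -
  interpret complete_measure "lebesgue_on {0<..<T}" by (rule complete_measure_Ioo)
  interpret finite_measure "lebesgue_on {0<..<T}" by (rule finite_measure_lebesgue_on_Ioo)
  have sm: "strongly_measurable (lebesgue_on {0<..<T}) f"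
    using assms by (simp add: L2_def)
  show ?thesis
  proof (rule Bochner_Integration.integrable_bound[OF _ strongly_measurable_norm[OF sm]])
    show "integrable (lebesgue_on {0<..<T}) (\<lambda>t. 1 + (norm (f t))\<^sup>2)"
      using assms by (auto simp: L2_def)
    have "norm (f t) \<le> 1 + (norm (f t))\<^sup>2" for t
      using sum_squares_bound[of "norm (f t)" 1] norm_ge_zero[of "f t"]
      by (simp only: power_one mult_1_right)
    then show "AE t in lebesgue_on {0<..<T}. norm (norm (f t)) \<le> norm (1 + (norm (f t))\<^sup>2)"
      by (intro AE_I2) simp
  qed
qed

section \<open>Integrals over subintervals, mean values and increments\<close>

lemma integrable_lebesgue_on_subinterval:
  fixes p :: "real \<Rightarrow> real"
  assumes p: "integrable (lebesgue_on {0<..<T}) p" and "0 \<le> a" "b \<le> T"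
  shows "integrable (lebesgue_on {a<..<b}) p" "p integrable_on {a..b}"
    "(LINT t|lebesgue_on {a<..<b}. p t) = integral {a..b} p"
proof -
  have "set_integrable lebesgue {0<..<T} p"
    using p by (simp add: integrable_restrict_space set_integrable_def)
  then have "set_integrable lebesgue {a<..<b} p"
    by (rule set_integrable_subset) (use assms in auto)
  then show *: "integrable (lebesgue_on {a<..<b}) p"
    by (simp add: integrable_restrict_space set_integrable_def)
  have "p integrable_on {a<..<b}"
    using integrable_on_lebesgue_on[OF *] by simp
  then show "p integrable_on {a..b}"
    by (simp add: integrable_on_open_interval_real)
  have "(LINT t|lebesgue_on {a<..<b}. p t) = integral {a<..<b} p"
    by (rule lebesgue_integral_eq_integral[OF *]) simp
  then show "(LINT t|lebesgue_on {a<..<b}. p t) = integral {a..b} p"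
    by (simp add: integral_open_interval_real)
qed

text \<open>If \<open>q\<close> exceeded its mean at every point of \<open>G\<close> in the
  interval, then integrating this strict inequality over a set of positive measure would give a
  contradiction. Since \<open>G\<close> has full measure, the point can be taken in it.\<close>

lemma ex_le_mean_value:
  fixes q :: "real \<Rightarrow> real"
  assumes q: "integrable (lebesgue_on {0<..<T}) q" and ae: "AE t in lebesgue_on {0<..<T}. t \<in> G"
    and ab: "0 \<le> a" "a < b" "b \<le> T"
  shows "\<exists>r\<in>G. a \<le> r \<and> r \<le> b \<and> (b - a) * q r \<le> integral {a..b} q"
proof (rule ccontr)
  let ?M = "lebesgue_on {a<..<b}"
  interpret finite_measure ?M by (rule finite_measure_lebesgue_on_Ioo)
  assume no: "\<not> ?thesis"
  have meas: "emeasure ?M (space ?M) = ennreal (b - a)"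
    using ab by (simp add: emeasure_restrict_space)
  have "AE t in ?M. t \<in> G"
    by (rule AE_lebesgue_on_subset[OF ae]) (use ab in auto)
  then have "AE t in ?M. integral {a..b} q < (b - a) * q t"
    using AE_space
  proof eventually_elim
    case (elim t)
    then show ?case using no by (auto simp: not_le dest!: bspec[of _ _ t])
  qed
  then have "(LINT t|?M. integral {a..b} q) < (LINT t|?M. (b - a) * q t)"
    using integrable_lebesgue_on_subinterval(1)[OF q ab(1,3)] ab meas
    by (intro integral_less_AE_space) auto
  moreover have "measure ?M (space ?M) = b - a"
    using meas ab by (simp add: measure_def)
  ultimately show False
    using integrable_lebesgue_on_subinterval(3)[OF q ab(1,3)] by simp
qed

lemma indefinite_integral_diff:
  fixes p :: "real \<Rightarrow> real"
  assumes "p integrable_on {0..T}" "0 \<le> a" "a \<le> b" "b \<le> T"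
  shows "integral {0..b} p - integral {0..a} p = integral {a..b} p"
proof -
  have "p integrable_on {0..b}"
    by (rule integrable_on_subinterval[OF assms(1)]) (use assms in auto)
  then show ?thesis
    using Henstock_Kurzweil_Integration.integral_combine[of 0 a b p] assms by simp
qed

text \<open>Testing both integrals with \<open>J - I\<close> itself turns their difference into one
  real integral over \<open>[a, b]\<close>. Cauchy-Schwarz leaves a factor
  \<open>norm (J - I)\<close> on both sides, which is cancelled; hence the separate case
  \<open>J = I\<close>.\<close>

lemma Bochner_integral_increment_le:
  fixes g :: "real \<Rightarrow> 'd::{real_inner, complete_space}"
  assumes g: "g \<in> L2 T" and ab: "0 \<le> a" "a \<le> b" "b \<le> T"
    and Ia: "has_Bochner_integral (lebesgue_on {0<..<a}) g I"
    and Ib: "has_Bochner_integral (lebesgue_on {0<..<b}) g J"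
  shows "norm (J - I) \<le> integral {a..b} (\<lambda>t. norm (g t))"
proof (cases "J = I")
  case True
  then show ?thesis using integrable_lebesgue_on_subinterval(2)[OF L2_integrable_norm[OF g] ab(1,3)]
    by (simp add: Henstock_Kurzweil_Integration.integral_nonneg)
next
  case False
  let ?y = "J - I"
  have sm: "strongly_measurable (lebesgue_on {0<..<T}) g" using g by (simp add: L2_def)
  note N = L2_integrable_norm[OF g]
  have gy: "integrable (lebesgue_on {0<..<T}) (\<lambda>t. g t \<bullet> ?y)"
  proof (rule Bochner_Integration.integrable_bound)
    show "integrable (lebesgue_on {0<..<T}) (\<lambda>t. norm (g t) * norm ?y)" using N by simp
    show "(\<lambda>t. g t \<bullet> ?y) \<in> borel_measurable (lebesgue_on {0<..<T})"
      by (rule complete_measure.strongly_measurable_inner[OF complete_measure_Ioo sm])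
    show "AE t in lebesgue_on {0<..<T}. norm (g t \<bullet> ?y) \<le> norm (norm (g t) * norm ?y)"
      by (intro AE_I2) (simp add: Cauchy_Schwarz_ineq2)
  qed
  note K = integrable_lebesgue_on_subinterval[OF gy]
  have "norm ?y * norm ?y = J \<bullet> ?y - I \<bullet> ?y"
    by (simp add: inner_diff_left[symmetric] dot_square_norm power2_eq_square)
  also have "J \<bullet> ?y = integral {0..b} (\<lambda>t. g t \<bullet> ?y)"
    using complete_measure.has_Bochner_integral_D(2)[OF complete_measure_Ioo Ib, of ?y] K(3)[of 0 b] ab by simp
  also have "I \<bullet> ?y = integral {0..a} (\<lambda>t. g t \<bullet> ?y)"
    using complete_measure.has_Bochner_integral_D(2)[OF complete_measure_Ioo Ia, of ?y] K(3)[of 0 a] ab by simp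
  also have "integral {0..b} (\<lambda>t. g t \<bullet> ?y) - integral {0..a} (\<lambda>t. g t \<bullet> ?y) =
      integral {a..b} (\<lambda>t. g t \<bullet> ?y)"
    by (rule indefinite_integral_diff[OF K(2)]) (use ab in auto)
  also have "\<dots> \<le> integral {a..b} (\<lambda>t. norm (g t) * norm ?y)"
  proof (rule integral_le)
    show "(\<lambda>t. g t \<bullet> ?y) integrable_on {a..b}" using K(2) ab by auto
    show "(\<lambda>t. norm (g t) * norm ?y) integrable_on {a..b}"
      using integrable_lebesgue_on_subinterval(2)[OF N ab(1,3)] by (rule integrable_on_mult_left)
  qed (rule norm_cauchy_schwarz)
  also have "\<dots> = integral {a..b} (\<lambda>t. norm (g t)) * norm ?y" by simp
  finally show ?thesis using False by simp
qed

lemma L2_has_Bochner_integral: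
  fixes g :: "real \<Rightarrow> 'd::{real_inner, complete_space}"
  assumes g: "g \<in> L2 T" and t: "t \<le> T"
  shows "\<exists>I. has_Bochner_integral (lebesgue_on {0<..<t}) g I"
proof -
  interpret complete_measure "lebesgue_on {0<..<t}" by (rule complete_measure_Ioo)
  show ?thesis
  proof (rule has_Bochner_integral_exists)
    show "strongly_measurable (lebesgue_on {0<..<t}) g"
      by (rule strongly_measurable_lebesgue_on_subset[of "{0<..<T}"]) (use g t in \<open>auto simp: L2_def\<close>)
    show "integrable (lebesgue_on {0<..<t}) (\<lambda>x. norm (g x))"
      by (rule integrable_lebesgue_on_subinterval(1)[OF L2_integrable_norm[OF g]]) (use t in auto)
  qed
qed

section \<open>Continuity in the middle space\<close>

text \<open>
  An energy estimate that needs no mollification. \<open>G\<close> is a set of good times, \<open>q\<close> stands for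
  $\|u\|_V^2$ and \<open>\<Lambda>\<close> for the integral of $\|u\|_V^2 + K^2 \|g\|_{V'}^2$, where $g$ is the
  derivative of $u$. Good times $r_k$ are
  picked in the dyadic intervals \<open>[c k, c (Suc k)]\<close> shrinking to \<open>t\<close>, with \<open>q\<close> at $r_k$ at most
  its mean value. Then $\|x_{r_k} - x_m\|^2$ grows by at most
  $2 (x_{r_{k+1}} - x_{r_k}, x_{r_{k+1}} - x_m)$ in each step, and these bounds telescope.
\<close>

lemma energy_estimate_right:
  fixes x :: "real \<Rightarrow> 'h::real_inner" and q \<Lambda> :: "real \<Rightarrow> real"
  assumes mono: "\<And>a b. m \<le> a \<Longrightarrow> a \<le> b \<Longrightarrow> b \<le> t \<Longrightarrow> \<Lambda> a \<le> \<Lambda> b"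
    and cont: "continuous_on {m..t} \<Lambda>"
    and q: "\<And>c. 0 \<le> q c"
    and increment: "\<And>a b c. a \<in> G \<Longrightarrow> b \<in> G \<Longrightarrow> c \<in> G \<Longrightarrow> m \<le> a \<Longrightarrow> a \<le> b \<Longrightarrow> b \<le> t \<Longrightarrow>
      \<bar>(x b - x a) \<bullet> x c\<bar> \<le> \<Lambda> b - \<Lambda> a + (b - a) * q c"
    and select: "\<And>a b. m \<le> a \<Longrightarrow> a < b \<Longrightarrow> b \<le> t \<Longrightarrow>
      \<exists>r\<in>G. a \<le> r \<and> r \<le> b \<and> (b - a) * q r \<le> \<Lambda> b - \<Lambda> a"
    and "m \<in> G" "t \<in> G" "m < t"
  shows "(norm (x t - x m))\<^sup>2 \<le> 10 * (\<Lambda> t - \<Lambda> m) + 2 * ((t - m) * q m)"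
proof -
  \<comment> \<open>Geometric intervals keep two distances comparable to the interval length: the
    gap between consecutive chosen points and the distance from a chosen point to \<open>t\<close>.
    The mean value bound therefore controls the product of \<open>q\<close> with either
    distance.\<close>
  define c where "c k = t - (t - m) * (1 / 2) ^ k" for k :: nat
  have c0: "c 0 = m" by (simp add: c_def)
  have c_mono: "c k < c (Suc k)" for k
    using \<open>m < t\<close> by (simp add: c_def)
  have c_less: "c k < t" for k
    using \<open>m < t\<close> by (simp add: c_def)
  have c_ge: "m \<le> c k" for k
    using c_mono by (induction k) (auto simp: c0 intro: order_trans less_imp_le)
  have c_step: "c (Suc (Suc k)) - c (Suc k) = (c (Suc k) - c k) / 2"
    "t - c k = 2 * (c (Suc k) - c k)" for k
    by (simp_all add: c_def field_simps)
  have c_lim: "c \<longlonglongrightarrow> t"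
  proof -
    have "(\<lambda>k. t - (t - m) * (1 / 2) ^ k) \<longlonglongrightarrow> t - (t - m) * 0"
      by (intro tendsto_intros LIMSEQ_realpow_zero) auto
    then show ?thesis by (simp add: c_def[abs_def])
  qed
  have "\<forall>k. \<exists>r. r \<in> G \<and> c k \<le> r \<and> r \<le> c (Suc k) \<and>
      (c (Suc k) - c k) * q r \<le> \<Lambda> (c (Suc k)) - \<Lambda> (c k)"
    using select c_ge c_mono c_less by (meson less_imp_le)
  then obtain \<rho> where \<rho>: "\<And>k. \<rho> k \<in> G" "\<And>k. c k \<le> \<rho> k" "\<And>k. \<rho> k \<le> c (Suc k)"
      "\<And>k. (c (Suc k) - c k) * q (\<rho> k) \<le> \<Lambda> (c (Suc k)) - \<Lambda> (c k)"
    by metis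
  \<comment> \<open>The index is shifted by one: \<open>r (Suc k)\<close> is the point chosen in
    \<open>[c k, c (Suc k)]\<close>, while the chain starts at \<open>m\<close>, where the norm to
    be bounded is 0.\<close>
  define r where "r k = (case k of 0 \<Rightarrow> m | Suc k \<Rightarrow> \<rho> k)" for k
  have r0: "r 0 = m" and rS: "r (Suc k) = \<rho> k" for k by (auto simp: r_def)
  have rG: "r k \<in> G" for k using \<rho> \<open>m \<in> G\<close> by (cases k) (auto simp: r_def)
  have r_le_c: "r k \<le> c k" for k using \<rho> by (cases k) (auto simp: r_def c0)
  have r_mono: "r k \<le> r (Suc k)" for k using r_le_c[of k] \<rho>(2)[of k] by (simp add: rS)
  have r_ge: "m \<le> r k" for k
    using r_mono by (induction k) (auto simp: r0 intro: order_trans)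
  have r_lt: "r k < t" for k using r_le_c[of k] c_less[of k] by simp
  \<comment> \<open>The gap covers at most the current interval and the previous one, which is twice
    as long; hence 3 = 1 + 2.\<close>
  have r_gap: "r (Suc k) - r k \<le> 3 * (c (Suc k) - c k)" for k
  proof (cases k)
    case 0
    then show ?thesis using r_le_c[of 1] c_mono[of 0] by (simp add: r0 c0)
  next
    case (Suc n)
    have "c n \<le> r k" using \<rho>(2)[of n] by (simp add: Suc rS)
    then show ?thesis
      using r_le_c[of "Suc k"] c_step(1)[of n] by (simp add: Suc)
  qed
  have rq: "(c (Suc k) - c k) * q (r (Suc k)) \<le> \<Lambda> (c (Suc k)) - \<Lambda> (c k)" for k
    using \<rho>(4) by (simp add: rS)
  \<comment> \<open>Two telescoping sums run in parallel. Pairing the increment with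
    \<open>x b\<close> and with \<open>x m\<close> gives 2 + 2 = 4 increments of \<Lambda> along
    \<open>r\<close>; the term \<open>2 * ((b - a) * q b)\<close> costs 2 times 3 = 6 increments
    along \<open>c\<close>. The terms with \<open>q m\<close> add up to the elapsed time and are
    kept.\<close>
  have bound: "(norm (x (r k) - x m))\<^sup>2 \<le>
      4 * (\<Lambda> (r k) - \<Lambda> m) + 6 * (\<Lambda> (c k) - \<Lambda> m) + 2 * ((r k - m) * q m)" for k
  proof (induction k)
    case 0
    show ?case by (simp add: r0 c0)
  next
    case (Suc k)
    define a where "a = r k"
    define b where "b = r (Suc k)"
    have ab: "a \<in> G" "b \<in> G" "m \<le> a" "a \<le> b" "b \<le> t"
      using rG r_ge r_mono r_lt[THEN less_imp_le] by (auto simp: a_def b_def)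
    have "(norm (x b - x m))\<^sup>2 - (norm (x a - x m))\<^sup>2
        = 2 * ((x b - x a) \<bullet> (x b - x m)) - (norm (x b - x a))\<^sup>2"
      by (simp add: power2_norm_eq_inner inner_diff_left inner_diff_right inner_commute)
    also have "\<dots> \<le> 2 * ((x b - x a) \<bullet> (x b - x m))" by simp
    also have "\<dots> = 2 * ((x b - x a) \<bullet> x b) - 2 * ((x b - x a) \<bullet> x m)"
      by (simp add: inner_diff_right)
    also have "\<dots> \<le> 2 * (\<Lambda> b - \<Lambda> a + (b - a) * q b) + 2 * (\<Lambda> b - \<Lambda> a + (b - a) * q m)"
    proof -
      have "2 * y - 2 * z \<le> 2 * Y + 2 * Z" if "\<bar>y\<bar> \<le> Y" "\<bar>z\<bar> \<le> Z" for y z Y Z :: real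
        using that by linarith
      from this[OF increment[OF ab(1,2,2,3-5)] increment[OF ab(1,2) \<open>m \<in> G\<close> ab(3-5)]]
      show ?thesis .
    qed
    finally have 1: "(norm (x b - x m))\<^sup>2 - (norm (x a - x m))\<^sup>2 \<le>
        4 * (\<Lambda> b - \<Lambda> a) + 2 * ((b - a) * q b) + 2 * ((b - a) * q m)" by (simp add: algebra_simps)
    have "(b - a) * q b \<le> 3 * (c (Suc k) - c k) * q b"
      using r_gap[of k] by (intro mult_right_mono q) (simp add: a_def b_def)
    also have "\<dots> \<le> 3 * (\<Lambda> (c (Suc k)) - \<Lambda> (c k))"
      using mult_left_mono[OF rq[of k], of 3] by (simp only: b_def mult.assoc)
    finally have 2: "(b - a) * q b \<le> 3 * (\<Lambda> (c (Suc k)) - \<Lambda> (c k))" .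
    show ?case
      using Suc 1 2 unfolding a_def b_def by (simp add: algebra_simps)
  qed
  have bound': "(norm (x (r k) - x m))\<^sup>2 \<le> 10 * (\<Lambda> t - \<Lambda> m) + 2 * ((t - m) * q m)" for k
  proof -
    have "\<Lambda> (r k) \<le> \<Lambda> t" "\<Lambda> (c k) \<le> \<Lambda> t"
      using r_ge c_ge r_lt[THEN less_imp_le] c_less[THEN less_imp_le] by (auto intro!: mono)
    then have "4 * (\<Lambda> (r k) - \<Lambda> m) + 6 * (\<Lambda> (c k) - \<Lambda> m) \<le> 10 * (\<Lambda> t - \<Lambda> m)" by simp
    moreover have "2 * ((r k - m) * q m) \<le> 2 * ((t - m) * q m)"
      using r_lt[of k] by (intro mult_left_mono mult_right_mono q) auto
    ultimately show ?thesis using bound[of k] by (meson add_mono order_trans)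
  qed
  have \<Lambda>_lim: "(\<lambda>k. \<Lambda> (X k)) \<longlonglongrightarrow> \<Lambda> t" if "X \<longlonglongrightarrow> t" "\<And>k. m \<le> X k" "\<And>k. X k \<le> t" for X
  proof (rule continuous_on_tendsto_compose[OF cont that(1)])
    show "t \<in> {m..t}" using \<open>m < t\<close> by simp
    show "eventually (\<lambda>k. X k \<in> {m..t}) sequentially" using that by (simp add: always_eventually)
  qed
  have r_lim: "(\<lambda>k. r (Suc k)) \<longlonglongrightarrow> t"
  proof (rule tendsto_sandwich[OF _ _ c_lim tendsto_const])
    show "eventually (\<lambda>k. c k \<le> r (Suc k)) sequentially" using \<rho>(2) by (simp add: rS)
    show "eventually (\<lambda>k. r (Suc k) \<le> t) sequentially" using r_lt[THEN less_imp_le] by simp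
  qed
  \<comment> \<open>Error of replacing \<open>x t\<close> by the chosen point before it. Nothing
    bounds \<open>q t\<close>, but its factor \<open>t - r (Suc k)\<close> tends to 0; the other two
    terms vanish by continuity of \<Lambda> at \<open>t\<close>.\<close>
  define e where "e k = 2 * (\<Lambda> t - \<Lambda> (r (Suc k))) + (t - r (Suc k)) * q t + 2 * (\<Lambda> (c (Suc k)) - \<Lambda> (c k))" for k
  have e_lim: "e \<longlonglongrightarrow> 0"
  proof -
    have "e \<longlonglongrightarrow> 2 * (\<Lambda> t - \<Lambda> t) + (t - t) * q t + 2 * (\<Lambda> t - \<Lambda> t)"
      unfolding e_def[abs_def]
      using r_lim r_ge r_lt c_lim LIMSEQ_Suc[OF c_lim] c_ge c_less
      by (intro tendsto_intros \<Lambda>_lim) (auto intro: less_imp_le)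
    then show ?thesis by simp
  qed
  have e: "(norm (x t - x (r (Suc k))))\<^sup>2 \<le> e k" for k
  proof -
    define b where "b = r (Suc k)"
    have b: "b \<in> G" "m \<le> b" "b \<le> t" using rG r_ge r_lt[THEN less_imp_le] by (auto simp: b_def)
    have "(norm (x t - x b))\<^sup>2 = (x t - x b) \<bullet> x t - (x t - x b) \<bullet> x b"
      by (simp add: power2_norm_eq_inner inner_diff_right)
    also have "\<dots> \<le> (\<Lambda> t - \<Lambda> b + (t - b) * q t) + (\<Lambda> t - \<Lambda> b + (t - b) * q b)"
      using increment[OF b(1) \<open>t \<in> G\<close> \<open>t \<in> G\<close> b(2,3)] increment[OF b(1) \<open>t \<in> G\<close> b(1) b(2,3)]
      by auto
    also have "(t - b) * q b \<le> (2 * (c (Suc k) - c k)) * q b"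
      using \<rho>(2)[of k] c_step(2)[of k] by (intro mult_right_mono q) (simp add: b_def rS)
    also have "\<dots> \<le> 2 * (\<Lambda> (c (Suc k)) - \<Lambda> (c k))"
      using mult_left_mono[OF rq[of k], of 2] by (simp only: b_def mult.assoc)
    finally show ?thesis by (simp add: e_def b_def)
  qed
  have "(\<lambda>k. (norm (x t - x (r (Suc k))))\<^sup>2) \<longlonglongrightarrow> 0"
    by (rule tendsto_sandwich[OF _ _ tendsto_const e_lim]) (simp_all add: e always_eventually)
  then have "(\<lambda>k. norm (x t - x (r (Suc k)))) \<longlonglongrightarrow> 0"
    by (simp add: tendsto_power_zero power_tendsto_0_iff)
  then have "(\<lambda>k. x (r (Suc k))) \<longlonglongrightarrow> x t"
    by (subst tendsto_dist_iff) (simp add: dist_norm norm_minus_commute)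
  then have "(\<lambda>k. (norm (x (r (Suc k)) - x m))\<^sup>2) \<longlonglongrightarrow> (norm (x t - x m))\<^sup>2"
    by (intro tendsto_intros)
  then show ?thesis
    by (rule LIMSEQ_le_const2) (use bound' in auto)
qed

text \<open>The one-sided estimate retains \<open>q\<close> at its starting point, which is
  uncontrolled for an arbitrary \<open>s\<close>. Starting instead from an intermediate
  \<open>m\<close> with \<open>(t - s) * q m \<le> \<Lambda> t - \<Lambda> s\<close> gives 10 + 2 =
  12 increments of \<Lambda> on each side, and the square of the triangle inequality yields 2 (12 +
  12) = 48.\<close>

lemma energy_estimate:
  fixes x :: "real \<Rightarrow> 'h::real_inner" and q \<Lambda> :: "real \<Rightarrow> real"
  assumes mono: "\<And>a b. s \<le> a \<Longrightarrow> a \<le> b \<Longrightarrow> b \<le> t \<Longrightarrow> \<Lambda> a \<le> \<Lambda> b"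
    and cont: "continuous_on {s..t} \<Lambda>"
    and q: "\<And>c. 0 \<le> q c"
    and increment: "\<And>a b c. a \<in> G \<Longrightarrow> b \<in> G \<Longrightarrow> c \<in> G \<Longrightarrow> s \<le> a \<Longrightarrow> a \<le> b \<Longrightarrow> b \<le> t \<Longrightarrow>
      \<bar>(x b - x a) \<bullet> x c\<bar> \<le> \<Lambda> b - \<Lambda> a + (b - a) * q c"
    and select: "\<And>a b. s \<le> a \<Longrightarrow> a < b \<Longrightarrow> b \<le> t \<Longrightarrow>
      \<exists>r\<in>G. a \<le> r \<and> r \<le> b \<and> (b - a) * q r \<le> \<Lambda> b - \<Lambda> a"
    and "s \<in> G" "t \<in> G" "s \<le> t"
  shows "(norm (x t - x s))\<^sup>2 \<le> 48 * (\<Lambda> t - \<Lambda> s)"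
proof (cases "s = t")
  case False
  then have "s < t" using \<open>s \<le> t\<close> by simp
  then obtain m where m: "m \<in> G" "s \<le> m" "m \<le> t" "(t - s) * q m \<le> \<Lambda> t - \<Lambda> s"
    using select[of s t] by auto
  have combine: "n \<le> 12 * D" if "n \<le> 10 * L + 2 * Q" "Q \<le> D" "L \<le> D" for n L Q D :: real
    using that by linarith
  have mm: "\<Lambda> s \<le> \<Lambda> m" "\<Lambda> m \<le> \<Lambda> t" using m by (auto intro!: mono)
  have R: "(norm (x t - x m))\<^sup>2 \<le> 12 * (\<Lambda> t - \<Lambda> s)"
  proof (cases "m = t")
    case True
    then show ?thesis using mm by simp
  next
    case False
    have "(norm (x t - x m))\<^sup>2 \<le> 10 * (\<Lambda> t - \<Lambda> m) + 2 * ((t - m) * q m)"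
    proof (rule energy_estimate_right[where G = G])
      show "continuous_on {m..t} \<Lambda>" using cont m by (auto elim: continuous_on_subset)
      show "\<exists>r\<in>G. a \<le> r \<and> r \<le> b \<and> (b - a) * q r \<le> \<Lambda> b - \<Lambda> a" if "m \<le> a" "a < b" "b \<le> t" for a b
        using select[of a b] that m by auto
    qed (use mono increment m q \<open>t \<in> G\<close> False in auto)
    moreover have "(t - m) * q m \<le> (t - s) * q m"
      using m by (intro mult_right_mono q) auto
    then have "(t - m) * q m \<le> \<Lambda> t - \<Lambda> s"
      using m(4) by (rule order_trans)
    moreover have "\<Lambda> t - \<Lambda> m \<le> \<Lambda> t - \<Lambda> s" using mm by simp
    ultimately show ?thesis using combine by blast
  qed
  have L: "(norm (x s - x m))\<^sup>2 \<le> 12 * (\<Lambda> t - \<Lambda> s)"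
  proof (cases "m = s")
    case True
    then show ?thesis using mm by simp
  next
    case False
    \<comment> \<open>Time reversal turns the way from \<open>m\<close> back to \<open>s\<close>
      into a forward one; \<Lambda> also changes sign so that it stays increasing. The double minus
      signs make this a literal instance of the one-sided estimate.\<close>
    have "(norm (x (- (- s)) - x (- (- m))))\<^sup>2 \<le>
        10 * (- \<Lambda> (- (- s)) - - \<Lambda> (- (- m))) + 2 * ((- s - - m) * q (- (- m)))"
    proof (rule energy_estimate_right[where G = "uminus ` G" and x = "\<lambda>t. x (- t)"
          and q = "\<lambda>t. q (- t)" and \<Lambda> = "\<lambda>t. - \<Lambda> (- t)"])
      show "continuous_on {- m.. - s} (\<lambda>t. - \<Lambda> (- t))"
        by (intro continuous_on_minus continuous_on_compose2[OF cont]) (use m in \<open>auto intro!: continuous_intros\<close>)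
      show "- \<Lambda> (- a) \<le> - \<Lambda> (- b)" if "- m \<le> a" "a \<le> b" "b \<le> - s" for a b
        using that m by (auto intro!: mono)
      show "\<bar>(x (- b) - x (- a)) \<bullet> x (- c)\<bar> \<le> - \<Lambda> (- b) - - \<Lambda> (- a) + (b - a) * q (- c)"
        if "a \<in> uminus ` G" "b \<in> uminus ` G" "c \<in> uminus ` G" "- m \<le> a" "a \<le> b" "b \<le> - s" for a b c
        using increment[of "- b" "- a" "- c"] that m by (auto simp: inner_diff_left abs_minus_commute)
      show "\<exists>r\<in>uminus ` G. a \<le> r \<and> r \<le> b \<and> (b - a) * q (- r) \<le> - \<Lambda> (- b) - - \<Lambda> (- a)"
        if ab: "- m \<le> a" "a < b" "b \<le> - s" for a b
      proof -
        obtain r where "r \<in> G" "- b \<le> r" "r \<le> - a" "(- a - - b) * q r \<le> \<Lambda> (- a) - \<Lambda> (- b)"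
          using select[of "- b" "- a"] ab m by auto
        then show ?thesis by (intro bexI[of _ "- r"]) auto
      qed
    qed (use q m \<open>s \<in> G\<close> False in auto)
    then have "(norm (x s - x m))\<^sup>2 \<le> 10 * (\<Lambda> m - \<Lambda> s) + 2 * ((m - s) * q m)" by simp
    moreover have "(m - s) * q m \<le> (t - s) * q m"
      using m by (intro mult_right_mono q) auto
    then have "(m - s) * q m \<le> \<Lambda> t - \<Lambda> s"
      using m(4) by (rule order_trans)
    moreover have "\<Lambda> m - \<Lambda> s \<le> \<Lambda> t - \<Lambda> s" using mm by simp
    ultimately show ?thesis using combine by blast
  qed
  have "(norm (x t - x s))\<^sup>2 \<le> (norm (x t - x m) + norm (x s - x m))\<^sup>2"
    using norm_triangle_ineq4[of "x t - x m" "x s - x m"] by (intro power_mono) auto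
  also have "\<dots> \<le> 2 * (norm (x t - x m))\<^sup>2 + 2 * (norm (x s - x m))\<^sup>2"
    using sum_squares_bound[of "norm (x t - x m)" "norm (x s - x m)"] by (simp add: power2_sum)
  finally show ?thesis using R L by linarith
qed simp

text \<open>This bridges the two notions of solution, from an equation holding at almost every time
  to one holding at all times for a version continuous in H. Here \<open>g\<close> stands for the
  whole right-hand side, of which only square integrability in V' matters.\<close>

lemma continuous_version:
  fixes i :: "'v::{real_inner, complete_space} \<Rightarrow> 'h::{real_inner, complete_space}"
    and j :: "'h \<Rightarrow> 'd::{real_inner, complete_space}"
  assumes nt: "normal_triple i j" and T: "0 < T" and u: "u \<in> L2 T" and g: "g \<in> L2 T"
    and sol: "AE t in lebesgue_on {0<..<T}.
      has_Bochner_integral (lebesgue_on {0<..<t}) g (j (i (u t)) - y\<^sub>0)"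
  shows "\<exists>U. continuous_on {0..T} U \<and> (AE t in lebesgue_on {0<..<T}. U t = i (u t)) \<and>
    (\<forall>t\<in>{0..T}. has_Bochner_integral (lebesgue_on {0<..<t}) g (j (U t) - y\<^sub>0))"
proof -
  have bl_j: "bounded_linear j" using nt by (simp add: normal_triple_def)
  then have j_diff: "j (a - b) = j a - j b" for a b
    by (simp add: bounded_linear.linear linear_diff)
  obtain K where K: "\<And>v h. \<bar>h \<bullet> i v\<bar> \<le> K * norm v * norm (j h)"
    using nt unfolding normal_triple_def by blast
  define x where "x t = i (u t)" for t
  have "\<forall>t\<in>{0..T}. \<exists>I. has_Bochner_integral (lebesgue_on {0<..<t}) g I"
    using L2_has_Bochner_integral[OF g] by auto
  then obtain I where I: "\<And>t. t \<in> {0..T} \<Longrightarrow> has_Bochner_integral (lebesgue_on {0<..<t}) g (I t)"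
    by metis
  \<comment> \<open>At these times the chosen representative of u satisfies the equation exactly, so
    \<open>j (x b - x a)\<close> is an increment of the integral of \<open>g\<close>.\<close>
  define G where "G = {t \<in> {0<..<T}. has_Bochner_integral (lebesgue_on {0<..<t}) g (j (x t) - y\<^sub>0)}"
  have G_sub: "G \<subseteq> {0..T}" by (auto simp: G_def)
  have AE_G: "AE t in lebesgue_on {0<..<T}. t \<in> G"
    using sol AE_space by eventually_elim (simp add: G_def x_def)
  have IG: "I t = j (x t) - y\<^sub>0" if "t \<in> G" for t
    using that I[of t] by (intro complete_measure.has_Bochner_integral_unique[OF complete_measure_Ioo]) (auto simp: G_def)
  have I_le: "norm (I b - I a) \<le> integral {a..b} (\<lambda>t. norm (g t))" if "0 \<le> a" "a \<le> b" "b \<le> T" for a b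
    using that by (intro Bochner_integral_increment_le[OF g] I) auto
  define q where "q t = (norm (u t))\<^sup>2" for t
  \<comment> \<open>The first summand absorbs the pairing inequality after 2xy \<le> x^2 + y^2; the
    second makes \<Lambda> dominate the integral of \<open>q\<close>, as needed for choosing points
    by their mean value.\<close>
  define p where "p t = K\<^sup>2 * (norm (g t))\<^sup>2 + q t" for t
  have int_q: "integrable (lebesgue_on {0<..<T}) q"
    using u by (simp add: L2_def q_def[abs_def])
  have int_g: "integrable (lebesgue_on {0<..<T}) (\<lambda>t. (norm (g t))\<^sup>2)"
    using g by (simp add: L2_def)
  have int_p: "integrable (lebesgue_on {0<..<T}) p"
    unfolding p_def[abs_def] using int_q int_g by simp
  note ion = integrable_lebesgue_on_subinterval(2)
  have p_ge: "0 \<le> p t" for t by (simp add: p_def q_def)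
  define \<Lambda> where "\<Lambda> t = integral {0..t} p" for t
  have \<Lambda>_diff: "\<Lambda> b - \<Lambda> a = integral {a..b} p" if "0 \<le> a" "a \<le> b" "b \<le> T" for a b
    unfolding \<Lambda>_def by (rule indefinite_integral_diff[OF ion[OF int_p]]) (use that in auto)
  have \<Lambda>_cont: "continuous_on {0..T} \<Lambda>"
    unfolding \<Lambda>_def[abs_def] by (rule indefinite_integral_continuous_1) (rule ion[OF int_p], auto)
  have \<Lambda>_mono: "\<Lambda> a \<le> \<Lambda> b" if "0 \<le> a" "a \<le> b" "b \<le> T" for a b
    using \<Lambda>_diff[OF that] Henstock_Kurzweil_Integration.integral_nonneg[OF ion[OF int_p], of a b] p_ge that by simp
  have increment: "\<bar>(x b - x a) \<bullet> x c\<bar> \<le> \<Lambda> b - \<Lambda> a + (b - a) * q c"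
    if "a \<in> G" "b \<in> G" "c \<in> G" "a \<le> b" for a b c
  proof -
    have ab: "0 \<le> a" "b \<le> T" using that G_sub by auto
    have "\<bar>(x b - x a) \<bullet> x c\<bar> \<le> K * norm (u c) * norm (j (x b - x a))"
      unfolding x_def by (rule K)
    also have "j (x b - x a) = I b - I a" using IG that by (simp add: j_diff)
    also have "K * norm (u c) * norm (I b - I a) \<le> \<bar>K\<bar> * norm (u c) * norm (I b - I a)"
      by (intro mult_right_mono) auto
    also have "\<dots> \<le> \<bar>K\<bar> * norm (u c) * integral {a..b} (\<lambda>t. norm (g t))"
      using I_le[of a b] ab that by (intro mult_left_mono) auto
    also have "\<dots> = integral {a..b} (\<lambda>t. \<bar>K\<bar> * norm (u c) * norm (g t))" by simp
    also have "\<dots> \<le> integral {a..b} (\<lambda>t. p t + q c)"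
    proof (rule integral_le)
      show "(\<lambda>t. \<bar>K\<bar> * norm (u c) * norm (g t)) integrable_on {a..b}"
        using ion[OF L2_integrable_norm[OF g] ab] by (rule integrable_on_mult_right)
      show "(\<lambda>t. p t + q c) integrable_on {a..b}"
        by (intro integrable_add ion[OF int_p ab] integrable_const_ivl)
      show "\<bar>K\<bar> * norm (u c) * norm (g t) \<le> p t + q c" for t
      proof -
        have "2 * (\<bar>K\<bar> * norm (g t)) * norm (u c) \<le> (\<bar>K\<bar> * norm (g t))\<^sup>2 + (norm (u c))\<^sup>2"
          by (rule sum_squares_bound)
        also have "\<dots> \<le> p t + q c"
          by (simp add: p_def q_def power_mult_distrib)
        finally have "2 * (\<bar>K\<bar> * norm (u c) * norm (g t)) \<le> p t + q c"
          by (simp only: mult_ac)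
        moreover have "0 \<le> \<bar>K\<bar> * norm (u c) * norm (g t)"
          by simp
        ultimately show ?thesis by linarith
      qed
    qed
    also have "\<dots> = integral {a..b} p + (b - a) * q c"
      using that by (subst Henstock_Kurzweil_Integration.integral_add) (auto intro!: ion[OF int_p ab])
    finally show ?thesis using \<Lambda>_diff[of a b] ab that by simp
  qed
  have select: "\<exists>r\<in>G. a \<le> r \<and> r \<le> b \<and> (b - a) * q r \<le> \<Lambda> b - \<Lambda> a"
    if "0 \<le> a" "a < b" "b \<le> T" for a b
  proof -
    have "integral {a..b} q \<le> integral {a..b} p"
      by (intro integral_le ion[OF int_p] ion[OF int_q]) (use that in \<open>auto simp: p_def\<close>)
    then show ?thesis
      using ex_le_mean_value[OF int_q AE_G that] \<Lambda>_diff[of a b] that by force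
  qed
  have energy: "(norm (x t - x s))\<^sup>2 \<le> 48 * (\<Lambda> t - \<Lambda> s)" if "s \<in> G" "t \<in> G" "s \<le> t" for s t
  proof (rule energy_estimate[where G = G and q = q])
    have st: "0 \<le> s" "t \<le> T" using that G_sub by auto
    then show "continuous_on {s..t} \<Lambda>" using \<Lambda>_cont by (auto elim: continuous_on_subset)
    show "\<Lambda> a \<le> \<Lambda> b" if "s \<le> a" "a \<le> b" "b \<le> t" for a b
      using that st by (intro \<Lambda>_mono) auto
    show "\<exists>r\<in>G. a \<le> r \<and> r \<le> b \<and> (b - a) * q r \<le> \<Lambda> b - \<Lambda> a" if "s \<le> a" "a < b" "b \<le> t" for a b
      using that st by (intro select) auto
  qed (use that increment in \<open>auto simp: q_def\<close>)
  have "uniformly_continuous_on G x"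
    unfolding uniformly_continuous_on_def
  proof (intro allI impI)
    fix e :: real assume e: "0 < e"
    have "uniformly_continuous_on {0..T} \<Lambda>"
      by (intro compact_uniformly_continuous \<Lambda>_cont) auto
    then obtain d where d: "d > 0"
      "\<And>s t. s \<in> {0..T} \<Longrightarrow> t \<in> {0..T} \<Longrightarrow> dist t s < d \<Longrightarrow> dist (\<Lambda> t) (\<Lambda> s) < e\<^sup>2 / 48"
      using e unfolding uniformly_continuous_on_def by (metis divide_pos_pos zero_less_numeral zero_less_power)
    have "dist (x t) (x s) < e" if "s \<in> G" "t \<in> G" "dist t s < d" for s t
    proof -
      have "(norm (x t - x s))\<^sup>2 \<le> 48 * \<bar>\<Lambda> t - \<Lambda> s\<bar>"
      proof (cases "s \<le> t")
        case True
        then show ?thesis using energy[of s t] that abs_ge_self[of "\<Lambda> t - \<Lambda> s"] by simp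
      next
        case False
        then show ?thesis
          using energy[of t s] that abs_ge_minus_self[of "\<Lambda> t - \<Lambda> s"] by (simp add: norm_minus_commute)
      qed
      also have "\<dots> < e\<^sup>2"
        using d(2)[OF subsetD[OF G_sub that(1)] subsetD[OF G_sub that(2)] that(3)]
        by (simp add: dist_real_def mult.commute)
      finally have "norm (x t - x s) < e"
        using e by (meson less_imp_le power_less_imp_less_base)
      then show ?thesis by (simp add: dist_norm)
    qed
    with d(1) show "\<exists>d>0. \<forall>s\<in>G. \<forall>t\<in>G. dist t s < d \<longrightarrow> dist (x t) (x s) < e" by blast
  qed
  then obtain U where U: "uniformly_continuous_on (closure G) U" "\<And>t. t \<in> G \<Longrightarrow> x t = U t"
    using uniformly_continuous_on_extension_on_closure by metis
  \<comment> \<open>Density comes from \<open>select\<close>, which places a point of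
    \<open>G\<close> in every subinterval of positive length. The neighbourhood of \<open>t\<close>
    is clipped to \<open>{0..T}\<close>, so both end points are reached.\<close>
  have cl: "closure G = {0..T}"
  proof
    show "closure G \<subseteq> {0..T}" using G_sub by (intro closure_minimal) auto
    show "{0..T} \<subseteq> closure G"
    proof
      fix t assume t: "t \<in> {0..T}"
      show "t \<in> closure G"
        unfolding closure_approachable
      proof (intro allI impI)
        fix e :: real assume e: "0 < e"
        have "0 \<le> max 0 (t - e / 2)" "max 0 (t - e / 2) < min T (t + e / 2)" "min T (t + e / 2) \<le> T"
          using e t T by auto
        then obtain r where "r \<in> G" "max 0 (t - e / 2) \<le> r" "r \<le> min T (t + e / 2)"
          using select by blast
        then show "\<exists>r\<in>G. dist r t < e"
          using e by (intro bexI[of _ r]) (auto simp: dist_real_def abs_less_iff)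
      qed
    qed
  qed
  have U_cont: "continuous_on {0..T} U"
    using U(1) cl uniformly_continuous_imp_continuous by metis
  have N_cont: "continuous_on {0..T} (\<lambda>t. integral {0..t} (\<lambda>t. norm (g t)))"
    by (rule indefinite_integral_continuous_1) (rule ion[OF L2_integrable_norm[OF g]], auto)
  have I_cont: "continuous_on {0..T} I"
    unfolding continuous_on_iff
  proof (intro ballI allI impI)
    fix s e :: real assume s: "s \<in> {0..T}" and e: "0 < e"
    let ?N = "\<lambda>t. integral {0..t} (\<lambda>t. norm (g t))"
    obtain d where d: "d > 0" "\<And>t. t \<in> {0..T} \<Longrightarrow> dist t s < d \<Longrightarrow> dist (?N t) (?N s) < e"
      using N_cont s e unfolding continuous_on_iff by metis
    have le: "norm (I b - I a) \<le> \<bar>?N b - ?N a\<bar>" if "a \<in> {0..T}" "b \<in> {0..T}" "a \<le> b" for a b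
    proof -
      have "?N b - ?N a = integral {a..b} (\<lambda>t. norm (g t))"
        by (rule indefinite_integral_diff[OF ion[OF L2_integrable_norm[OF g]]]) (use that in auto)
      then show ?thesis using I_le[of a b] that by auto
    qed
    have "dist (I t) (I s) < e" if "t \<in> {0..T}" "dist t s < d" for t
      using d(2)[OF that] le[of s t] le[of t s] s that
      by (cases "s \<le> t") (auto simp: dist_norm norm_minus_commute abs_minus_commute)
    with d(1) show "\<exists>d>0. \<forall>t\<in>{0..T}. dist t s < d \<longrightarrow> dist (I t) (I s) < e" by blast
  qed
  \<comment> \<open>Both \<open>j (U t) - y\<^sub>0\<close> and \<open>I t\<close> are continuous
    into V' and agree on the dense set \<open>G\<close>. This extends the equation to every time,
    including 0 and \<open>T\<close>.\<close>
  have "j (U t) - y\<^sub>0 - I t = 0" if "t \<in> {0..T}" for t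
  proof (rule continuous_constant_on_closure[of G "\<lambda>t. j (U t) - y\<^sub>0 - I t"])
    show "continuous_on (closure G) (\<lambda>t. j (U t) - y\<^sub>0 - I t)"
      unfolding cl by (intro continuous_intros I_cont bounded_linear.continuous_on[OF bl_j] U_cont)
    show "j (U t) - y\<^sub>0 - I t = 0" if "t \<in> G" for t
      using IG[OF that] U(2)[OF that] by simp
  qed (use that cl in simp)
  then have "has_Bochner_integral (lebesgue_on {0<..<t}) g (j (U t) - y\<^sub>0)" if "t \<in> {0..T}" for t
    using I[OF that] that by simp
  moreover have "AE t in lebesgue_on {0<..<T}. U t = i (u t)"
    using AE_G by eventually_elim (simp add: U(2)[symmetric] x_def)
  ultimately show ?thesis using U_cont by blast
qed

section \<open>The chaos coefficients\<close>

definition degree_mi :: "multi_index \<Rightarrow> nat" where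
  "degree_mi \<alpha> = (\<Sum>k\<in>Poly_Mapping.keys \<alpha>. Poly_Mapping.lookup \<alpha> k)"

text \<open>Subtraction of multi-indices is truncated, so the order drops only at a position of the
  support. This decrease drives the recursion for the coefficients and the inductions on
  them.\<close>

lemma degree_mi_diff_single:
  assumes "k \<in> Poly_Mapping.keys \<alpha>"
  shows "degree_mi (\<alpha> - Poly_Mapping.single k 1) < degree_mi \<alpha>"
proof -
  let ?\<beta> = "\<alpha> - Poly_Mapping.single k 1"
  have le: "Poly_Mapping.lookup ?\<beta> l \<le> Poly_Mapping.lookup \<alpha> l" for l
    by (simp add: lookup_minus)
  then have "Poly_Mapping.keys ?\<beta> \<subseteq> Poly_Mapping.keys \<alpha>"
    by (metis in_keys_iff le_zero_eq subsetI)
  then have "degree_mi ?\<beta> = (\<Sum>l\<in>Poly_Mapping.keys \<alpha>. Poly_Mapping.lookup ?\<beta> l)"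
    unfolding degree_mi_def by (intro sum.mono_neutral_left) (auto simp: in_keys_iff)
  also have "\<dots> < degree_mi \<alpha>"
    unfolding degree_mi_def
  proof (rule sum_strict_mono_ex1)
    show "\<exists>l\<in>Poly_Mapping.keys \<alpha>. Poly_Mapping.lookup ?\<beta> l < Poly_Mapping.lookup \<alpha> l"
      using assms by (intro bexI[of _ k]) (auto simp: lookup_minus in_keys_iff)
  qed (use le in auto)
  finally show ?thesis .
qed

section \<open>Countability of the multi-indices, weights and the recursion\<close>

lemma countable_multi_index: "countable (UNIV :: multi_index set)"
proof -
  \<comment> \<open>The code of a multi-index is the graph of its nonzero entries, a finite subset
    of a countable set.\<close>
  let ?h = "\<lambda>\<alpha> :: multi_index. (\<lambda>k. (k, Poly_Mapping.lookup \<alpha> k)) ` Poly_Mapping.keys \<alpha>"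
  have "inj ?h"
  proof (rule injI)
    fix \<alpha> \<beta> :: multi_index assume eq: "?h \<alpha> = ?h \<beta>"
    have mem: "(k, n) \<in> ?h \<gamma> \<longleftrightarrow> n \<noteq> 0 \<and> Poly_Mapping.lookup \<gamma> k = n" for k n and \<gamma> :: multi_index
      by (auto simp: in_keys_iff)
    show "\<alpha> = \<beta>"
    proof (rule poly_mapping_eqI)
      show "Poly_Mapping.lookup \<alpha> k = Poly_Mapping.lookup \<beta> k" for k
        using mem[of k "Poly_Mapping.lookup \<alpha> k" \<alpha>] mem[of k "Poly_Mapping.lookup \<alpha> k" \<beta>]
          mem[of k "Poly_Mapping.lookup \<beta> k" \<alpha>] mem[of k "Poly_Mapping.lookup \<beta> k" \<beta>] eq by metis
    qed
  qed
  moreover have "countable (range ?h)"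
    by (rule countable_subset[OF _ countable_Collect_finite]) auto
  ultimately show ?thesis
    by (meson countable_image_inj_on)
qed

lemma ex_bounded_weights_RL2:
  assumes "\<And>\<alpha>. u \<alpha> \<in> X"
  shows "\<exists>r. bounded_weights r \<and> u \<in> RL2 r X nrm"
proof -
  obtain n :: "multi_index \<Rightarrow> nat" where n: "inj n"
    using countable_multi_index unfolding countable_def by blast
  \<comment> \<open>The denominator cancels the size of the coefficient, with 1 added to keep it
    positive and the weights at most 1. The numerator makes each squared term at most
    \<open>(1 / 4) ^ n \<alpha>\<close>, a subfamily of a geometric series because \<open>n\<close>
    is injective.\<close>
  define r where "r \<alpha> = (1 / 2) ^ n \<alpha> / (1 + \<bar>nrm (u \<alpha>)\<bar>)" for \<alpha>
  have pos: "0 < 1 + \<bar>nrm (u \<alpha>)\<bar>" for \<alpha> by (simp add: add_pos_nonneg)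
  have r_pos: "0 < r \<alpha>" for \<alpha> using pos by (simp add: r_def)
  have r_le: "r \<alpha> \<le> 1" for \<alpha>
  proof -
    have "(1 / 2) ^ n \<alpha> \<le> (1::real)" by (intro power_le_one) auto
    then show ?thesis unfolding r_def using pos[of \<alpha>] by (subst divide_le_eq_1_pos) auto
  qed
  have "(\<lambda>k::nat. (1 / 4) ^ k :: real) summable_on UNIV"
    by (subst summable_on_UNIV_nonneg_real_iff) (auto intro: summable_geometric)
  then have "(\<lambda>k::nat. (1 / 4) ^ k :: real) summable_on range n"
    by (rule summable_on_subset) auto
  then have S: "(\<lambda>\<alpha>. (1 / 4) ^ n \<alpha> :: real) summable_on UNIV"
    by (subst (asm) summable_on_reindex[OF n]) (simp add: o_def)
  have le: "(r \<alpha>)\<^sup>2 * (nrm (u \<alpha>))\<^sup>2 \<le> (1 / 4) ^ n \<alpha>" for \<alpha>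
  proof -
    have "r \<alpha> * \<bar>nrm (u \<alpha>)\<bar> \<le> (1 / 2) ^ n \<alpha>"
      unfolding r_def using pos[of \<alpha>] by (simp add: divide_le_eq algebra_simps)
    then have "(r \<alpha> * \<bar>nrm (u \<alpha>)\<bar>)\<^sup>2 \<le> ((1 / 2 :: real) ^ n \<alpha>)\<^sup>2"
      using r_pos[of \<alpha>] by (intro power_mono) auto
    also have "((1 / 2 :: real) ^ n \<alpha>)\<^sup>2 = (1 / 4) ^ n \<alpha>"
      unfolding power2_eq_square power_mult_distrib[symmetric] by simp
    finally show ?thesis
      by (simp add: power_mult_distrib)
  qed
  have "(\<lambda>\<alpha>. (r \<alpha>)\<^sup>2 * (nrm (u \<alpha>))\<^sup>2) summable_on UNIV"
    by (rule summable_on_comparison_test[OF S]) (use le in auto)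
  then show ?thesis
    using r_pos r_le assms by (intro exI[of _ r]) (auto simp: bounded_weights_def RL2_def)
qed

text \<open>The parameter \<open>S\<close> is meant as a solution operator of the deterministic
  problem, sending initial value and forcing to a solution; coefficients of lower order enter
  through the forcing. Termination uses that the summation index lies in the support.\<close>

function chaos_coeff ::
    "('h \<Rightarrow> (real \<Rightarrow> 'd) \<Rightarrow> real \<Rightarrow> 'v) \<Rightarrow> (nat \<Rightarrow> 'v \<Rightarrow> 'd::real_vector) \<Rightarrow>
     (multi_index \<Rightarrow> 'h) \<Rightarrow> (multi_index \<Rightarrow> real \<Rightarrow> 'd) \<Rightarrow> multi_index \<Rightarrow> real \<Rightarrow> 'v" where
  "chaos_coeff S M u\<^sub>0 f \<alpha> = S (u\<^sub>0 \<alpha>) (\<lambda>s. f \<alpha> s + (\<Sum>k\<in>Poly_Mapping.keys \<alpha>.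
     sqrt (real (Poly_Mapping.lookup \<alpha> k)) *\<^sub>R
       M k (chaos_coeff S M u\<^sub>0 f (\<alpha> - Poly_Mapping.single k 1) s)))"
  by pat_completeness auto
termination
  by (relation "Wellfounded.measure (\<lambda>(S, M, u\<^sub>0, f, \<alpha>). degree_mi \<alpha>)") (use degree_mi_diff_single in auto)

declare chaos_coeff.simps [simp del]

section \<open>Existence and uniqueness of the chaos solution\<close>

theorem theorem10:
  fixes P :: "'w measure"
    and \<uu> :: "nat \<Rightarrow> 'u :: {real_inner, complete_space}"
    and W :: "'u \<Rightarrow> 'w \<Rightarrow> real"
    and i :: "'v :: {real_inner, complete_space} \<Rightarrow> 'h :: {real_inner, complete_space}"
    and j :: "'h \<Rightarrow> 'd :: {real_inner, complete_space}"
    and A :: "'v \<Rightarrow> 'd"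
    and M :: "nat \<Rightarrow> 'v \<Rightarrow> 'd"
    and T :: real
    and u\<^sub>0 :: "multi_index \<Rightarrow> 'h"
    and f :: "multi_index \<Rightarrow> real \<Rightarrow> 'd"
    and r' :: "multi_index \<Rightarrow> real"
  assumes "white_noise P \<uu> W"
    and "normal_triple i j"
    and "T > 0"
    and "bounded_linear A"
    and "assumption_A i j A T"
    and "\<And>k. bounded_linear (M k)"
    and "bounded_weights r'"
    and "u\<^sub>0 \<in> RL2 r' UNIV norm"
    and "f \<in> RL2 r' (L2 T) (L2_norm T)"
  shows "\<exists>r. bounded_weights r \<and>
    (\<exists>u \<in> RL2 r (L2 T) (L2_norm T).
       chaos_solution i j A M T u\<^sub>0 f u \<and>
       (\<forall>v \<in> RL2 r (L2 T) (L2_norm T). chaos_solution i j A M T u\<^sub>0 f v \<longrightarrow>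
          (\<forall>\<alpha>. AE t in lebesgue_on {0<..<T}. v \<alpha> t = u \<alpha> t)))"
proof -
  note nt = \<open>normal_triple i j\<close> and T = \<open>T > 0\<close> and blA = \<open>bounded_linear A\<close>
    and blM = \<open>\<And>k. bounded_linear (M k)\<close>
  have bl: "bounded_linear i" "bounded_linear j" using nt by (auto simp: normal_triple_def)
  note diff = bl[THEN bounded_linear.linear, THEN linear_diff] bl[THEN bounded_linear.linear, THEN linear_0]
    blA[THEN bounded_linear.linear, THEN linear_diff] blM[THEN bounded_linear.linear, THEN linear_diff]
  have f: "f \<alpha> \<in> L2 T" for \<alpha> using \<open>f \<in> RL2 r' (L2 T) (L2_norm T)\<close> by (simp add: RL2_def)
  obtain S where S: "\<And>U\<^sub>0 F. F \<in> L2 T \<Longrightarrow> deterministic_solution i j A T U\<^sub>0 F (S U\<^sub>0 F)"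
    using \<open>assumption_A i j A T\<close> unfolding assumption_A_def by metis
  obtain C where C: "\<And>U\<^sub>0 F U. F \<in> L2 T \<Longrightarrow> deterministic_solution i j A T U\<^sub>0 F U \<Longrightarrow>
      L2_norm T U \<le> C * (norm U\<^sub>0 + L2_norm T F)"
    using \<open>assumption_A i j A T\<close> unfolding assumption_A_def by blast
  define noise where "noise v \<alpha> s = (\<Sum>k\<in>Poly_Mapping.keys \<alpha>. sqrt (real (Poly_Mapping.lookup \<alpha> k)) *\<^sub>R
     M k (v (\<alpha> - Poly_Mapping.single k 1) s))" for v :: "multi_index \<Rightarrow> real \<Rightarrow> 'v" and \<alpha> s
  have noise_L2: "noise v \<alpha> \<in> L2 T"
    if "\<And>k. k \<in> Poly_Mapping.keys \<alpha> \<Longrightarrow> v (\<alpha> - Poly_Mapping.single k 1) \<in> L2 T" for v \<alpha>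
    unfolding noise_def[abs_def] using that by (intro L2_sum L2_scaleR L2_bounded_linear[OF _ blM])
  define u where "u = chaos_coeff S M u\<^sub>0 f"
  have u_eq: "u \<alpha> = S (u\<^sub>0 \<alpha>) (\<lambda>s. f \<alpha> s + noise u \<alpha> s)" for \<alpha>
    unfolding u_def noise_def by (rule chaos_coeff.simps)
  \<comment> \<open>\<open>S\<close> is specified only for forcing in \<open>L2 T\<close>, so square
    integrability has to be carried along the recursion before the equation for any coefficient can
    be used.\<close>
  have u_L2: "u \<alpha> \<in> L2 T" for \<alpha>
  proof (induction "degree_mi \<alpha>" arbitrary: \<alpha> rule: less_induct)
    case less
    then have "noise u \<alpha> \<in> L2 T" using degree_mi_diff_single by (intro noise_L2) blast
    from S[OF L2_add[OF f this]] show ?case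
      unfolding u_eq[of \<alpha>] by (simp add: deterministic_solution_def)
  qed
  have F_L2: "(\<lambda>s. f \<alpha> s + noise u \<alpha> s) \<in> L2 T" for \<alpha>
    by (intro L2_add f noise_L2 u_L2)
  have u_sol: "chaos_solution i j A M T u\<^sub>0 f u"
    unfolding chaos_solution_def noise_def[symmetric]
  proof
    fix \<alpha>
    have "deterministic_solution i j A T (u\<^sub>0 \<alpha>) (\<lambda>s. f \<alpha> s + noise u \<alpha> s) (u \<alpha>)"
      unfolding u_eq[of \<alpha>] by (rule S[OF F_L2])
    then show "\<exists>U. continuous_on {0..T} U \<and> (AE t in lebesgue_on {0<..<T}. U t = i (u \<alpha> t)) \<and>
        (\<forall>t\<in>{0..T}. has_Bochner_integral (lebesgue_on {0<..<t})
          (\<lambda>s. A (u \<alpha> s) + f \<alpha> s + noise u \<alpha> s) (j (U t) - j (u\<^sub>0 \<alpha>)))"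
      \<comment> \<open>Reassociation splits the integrand into \<open>A (u \<alpha> s)\<close> and
        the forcing given to \<open>S\<close>.\<close>
      unfolding add.assoc deterministic_solution_def
      by (intro continuous_version[OF nt T u_L2] L2_add[OF L2_bounded_linear[OF u_L2 blA] F_L2]) blast
  qed
  \<comment> \<open>The weights do not enter here. The difference of two solutions has initial value
    0 and is forced only by differences of lower coefficients, which vanish almost everywhere by
    induction on the order.\<close>
  have unique: "AE t in lebesgue_on {0<..<T}. v \<alpha> t = u \<alpha> t"
    if v_L2: "\<And>\<alpha>. v \<alpha> \<in> L2 T" and v_sol: "chaos_solution i j A M T u\<^sub>0 f v" for v \<alpha>
  proof (induction "degree_mi \<alpha>" arbitrary: \<alpha> rule: less_induct)
    case less
    define F where "F s = noise v \<alpha> s - noise u \<alpha> s" for s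
    define w where "w t = v \<alpha> t - u \<alpha> t" for t
    have F_L2: "F \<in> L2 T" unfolding F_def[abs_def] by (intro L2_diff noise_L2 v_L2 u_L2)
    have w_L2: "w \<in> L2 T" unfolding w_def[abs_def] by (intro L2_diff v_L2 u_L2)
    \<comment> \<open>The support is finite, so the exceptional null sets of the lower coefficients
      combine into a single one.\<close>
    have "AE t in lebesgue_on {0<..<T}. \<forall>k\<in>Poly_Mapping.keys \<alpha>.
        v (\<alpha> - Poly_Mapping.single k 1) t = u (\<alpha> - Poly_Mapping.single k 1) t"
      using less degree_mi_diff_single by (intro AE_finite_allI) auto
    then have "AE t in lebesgue_on {0<..<T}. F t = 0"
      by eventually_elim (simp add: F_def noise_def)
    then have F0: "L2_norm T F \<le> 0" using L2_norm_le_zero_iff[OF F_L2] by simp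
    obtain V where V: "AE t in lebesgue_on {0<..<T}. V t = i (v \<alpha> t)"
      "\<And>t. t \<in> {0..T} \<Longrightarrow> has_Bochner_integral (lebesgue_on {0<..<t})
         (\<lambda>s. A (v \<alpha> s) + f \<alpha> s + noise v \<alpha> s) (j (V t) - j (u\<^sub>0 \<alpha>))"
      using v_sol unfolding chaos_solution_def noise_def[symmetric] by blast
    obtain U where U: "AE t in lebesgue_on {0<..<T}. U t = i (u \<alpha> t)"
      "\<And>t. t \<in> {0..T} \<Longrightarrow> has_Bochner_integral (lebesgue_on {0<..<t})
         (\<lambda>s. A (u \<alpha> s) + f \<alpha> s + noise u \<alpha> s) (j (U t) - j (u\<^sub>0 \<alpha>))"
      using u_sol unfolding chaos_solution_def noise_def[symmetric] by blast
    have "AE t in lebesgue_on {0<..<T}.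
        has_Bochner_integral (lebesgue_on {0<..<t}) (\<lambda>s. A (w s) + F s) (j (i (w t)) - j 0)"
      using V(1) U(1) AE_space
    proof eventually_elim
      case (elim t)
      then have t: "t \<in> {0..T}" by simp
      show ?case
        using complete_measure.has_Bochner_integral_diff[OF complete_measure_Ioo V(2)[OF t] U(2)[OF t]] elim
        by (simp add: w_def F_def diff algebra_simps)
    qed
    then have "deterministic_solution i j A T 0 F w"
      using w_L2 by (simp add: deterministic_solution_def)
    \<comment> \<open>The sign of \<open>C\<close> is not given, so the norm of \<open>F\<close>
      must be exactly 0; this combines \<open>F0\<close> with nonnegativity.\<close>
    from C[OF F_L2 this] have "L2_norm T w \<le> 0"
      using F0 L2_norm_nonneg[of T F] by simp
    then show ?case
      using L2_norm_le_zero_iff[OF w_L2] by (simp add: w_def)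
  qed
  obtain r where "bounded_weights r" "u \<in> RL2 r (L2 T) (L2_norm T)"
    using ex_bounded_weights_RL2[of u, OF u_L2] by blast
  then show ?thesis
    using u_sol unique by (intro exI[of _ r] conjI bexI[of _ u]) (auto simp: RL2_def)
qed

end
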